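(* Let $\mathbb{A}_3^c$ be the colorful associahedron of the hexagon with colors $\{O,B,G\}$. The mutation formula attached to a sequence of flips of colored triangulations on $\mathbb{A}_3^c$ is path-independent: if two sequences of flips both start at a colored triangulation $T$ and both end at a colored triangulation $T'$, then the two corresponding sequences of cluster $\mathcal{X}$-mutations express the final coordinates as the same rational functions of the initial coordinates $(Z_O,Z_B,Z_G)$; i.e. the mapping of clusters is uniquely determined by the initial and the final triangulations. In particular, for equilateral triangulations on $\mathbb{A}_3^c$ the rotation by $\pi$ admits a well-defined involutive mutation formula: for every equilateral colored triangulation $T$, the coordinate transformation attached to any sequence of flips from $T$ to its rotation $\rho_\pi(T)$ by $\pi$ is independent of the sequence, and it is an involution of $\mathbb{C}(Z_O,Z_B,Z_G)$. On the reference triangulation this explicit map of clusters reads $$Z_O\longmapsto\frac{1+Z_O+Z_OZ_B}{Z_B(1+Z_G+Z_OZ_G)},\qquad Z_B\longmapsto\frac{1+Z_B+Z_BZ_G}{Z_G(1+Z_O+Z_OZ_B)},\qquad Z_G\longmapsto\frac{1+Z_G+Z_OZ_G}{Z_O(1+Z_B+Z_BZ_G)}.$$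
   Context: **Colored triangulations and the colorful associahedron.** A colored triangulation of the regular hexagon is a triple of pairwise non-crossing diagonals (chords) cutting it into four triangles, together with a bijection from the three chords to the set of colors $\{O,B,G\}$. Flipping the chord of color $\alpha$ removes it and inserts the other diagonal of the resulting quadrilateral, with the same color $\alpha$. The colorful associahedron $\mathbb{A}_3^c$ has the 84 colored triangulations as vertices and the flips as edges (a connected 3-regular graph); a sequence of flips is a path in this graph. A triangulation is equilateral if its three chords form an equilateral triangle; there are twelve equilateral colored triangulations. Rotation $\rho_\pi$ of the hexagon by $\pi$ carries colors along, and maps equilateral colored triangulations to equilateral ones. **Quiver and mutations.** To a colored triangulation attach a quiver with vertex set $\{O,B,G\}$: inside each of the four triangles, draw an arrow from each side that is a chord to the next side in counterclockwise order whenever that side is also a chord. (The quiver of $T$ and of $\rho_\pi(T)$ coincide.) Let $\epsilon_{ij}$ be the signed number of arrows from $i$ to $j$. Attach to each color $\alpha$ a cluster $\mathcal{X}$-coordinate $Z_\alpha$. The flip of the chord colored $k$ corresponds to the mutation $\mu_k$, which changes the quiver by the usual mutation rule (add an arrow $i\to j$ for each path $i\to k\to j$, reverse the arrows at $k$, cancel 2-cycles) and changes the coordinates by $$Z_k'=Z_k^{-1},\qquad Z_i'=Z_i\big(1+Z_k^{-\mathrm{sgn}(\epsilon_{ik})}\big)^{-\epsilon_{ik}}\quad(i\neq k).$$ The mutation formula attached to a path of flips starting at $T$ is the triple of rational functions expressing the final coordinates $(Z'_O,Z'_B,Z'_G)$ in terms of independent variables $(Z_O,Z_B,Z_G)$ placed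 at $T$. It is identified with the substitution $Z_\alpha\mapsto Z'_\alpha(Z_O,Z_B,Z_G)$. **Reference triangulation.** It is an equilateral triangulation whose chords are colored $O,G,B$ in counterclockwise order, so that its quiver is the 3-cycle $O\to G\to B\to O$. *)

theory Defs
  imports "HOL-Computational_Algebra.Computational_Algebra"
begin

section \<open>Colored triangulations of the hexagon\<close>

text \<open>The vertices of the hexagon are 0, ..., 5 in counterclockwise order.\<close>

definition hexagon_edges :: "nat set set" where
  "hexagon_edges = {{v, (v + 1) mod 6} | v. v < 6}"

definition diagonals :: "nat set set" where
  "diagonals = {{a, b} | a b. a < 6 \<and> b < 6 \<and> a \<noteq> b} - hexagon_edges"

definition ccw :: "nat \<Rightarrow> nat \<Rightarrow> nat \<Rightarrow> bool" where
  "ccw a b c \<longleftrightarrow> a < b \<and> b < c \<or> b < c \<and> c < a \<or> c < a \<and> a < b"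

definition crossing :: "nat set \<Rightarrow> nat set \<Rightarrow> bool" where
  "crossing d e \<longleftrightarrow> (\<exists>a b a' b'. d = {a, b} \<and> e = {a', b'} \<and> ccw a a' b \<and> ccw b b' a)"

datatype color = Orange | Blue | Green

text \<open>A coloring is recorded as the inverse bijection, from the colors to the chords.\<close>

type_synonym triangulation = "color \<Rightarrow> nat set"

definition colored_triangulation :: "triangulation \<Rightarrow> bool" where
  "colored_triangulation T \<longleftrightarrow>
     inj T \<and> range T \<subseteq> diagonals \<and> (\<forall>\<alpha> \<beta>. \<not> crossing (T \<alpha>) (T \<beta>))"

definition sides :: "triangulation \<Rightarrow> nat set set" where
  "sides T = hexagon_edges \<union> range T"

definition flip :: "color \<Rightarrow> triangulation \<Rightarrow> triangulation \<Rightarrow> bool" where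
  "flip k T T' \<longleftrightarrow>
     (\<exists>a b c d. ccw a b c \<and> ccw a c d \<and> {{a, b}, {b, c}, {c, d}, {d, a}} \<subseteq> sides T \<and>
        T k = {a, c} \<and> T' = T(k := {b, d}))"

text \<open>A path of flips is recorded by the colors of the chords that are flipped, in order.\<close>

inductive flip_path :: "triangulation \<Rightarrow> color list \<Rightarrow> triangulation \<Rightarrow> bool" where
  Nil: "flip_path T [] T"
| Cons: "flip k T T' \<Longrightarrow> flip_path T' ks T'' \<Longrightarrow> flip_path T (k # ks) T''"

definition equilateral :: "triangulation \<Rightarrow> bool" where
  "equilateral T \<longleftrightarrow>
     (\<exists>a<6. range T = {{a, (a + 2) mod 6}, {(a + 2) mod 6, (a + 4) mod 6}, {(a + 4) mod 6, a}})"

definition reference_triangulation :: "triangulation \<Rightarrow> bool" where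
  "reference_triangulation T \<longleftrightarrow>
     (\<exists>a<6. T Orange = {a, (a + 2) mod 6} \<and>
            T Green = {(a + 2) mod 6, (a + 4) mod 6} \<and>
            T Blue = {(a + 4) mod 6, a})"

definition rotate_pi :: "triangulation \<Rightarrow> triangulation" where
  "rotate_pi T = (\<lambda>\<alpha>. (\<lambda>v. (v + 3) mod 6) ` T \<alpha>)"


section \<open>Quivers and mutations\<close>

text \<open>A quiver without loops and 2-cycles is given by its signed arrow counts.\<close>

type_synonym quiver = "color \<Rightarrow> color \<Rightarrow> int"

text \<open>Three vertices that are pairwise joined by sides of \<open>T\<close> always span one of the four
  triangles of \<open>T\<close>, because the hexagon has no interior vertices.\<close>

definition arrows :: "triangulation \<Rightarrow> color \<Rightarrow> color \<Rightarrow> (nat \<times> nat \<times> nat) set" where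
  "arrows T i j = {(a, b, c). ccw a b c \<and> {{a, b}, {b, c}, {c, a}} \<subseteq> sides T \<and>
                     T i = {a, b} \<and> T j = {b, c}}"

definition quiver_of :: "triangulation \<Rightarrow> quiver" where
  "quiver_of T i j = int (card (arrows T i j)) - int (card (arrows T j i))"

definition mutate_quiver :: "color \<Rightarrow> quiver \<Rightarrow> quiver" where
  "mutate_quiver k \<epsilon> i j =
     (if i = k \<or> j = k then - \<epsilon> i j
      else \<epsilon> i j + max 0 (\<epsilon> i k) * max 0 (\<epsilon> k j) - max 0 (\<epsilon> j k) * max 0 (\<epsilon> k i))"

definition mutate_coords :: "color \<Rightarrow> quiver \<Rightarrow> (color \<Rightarrow> 'a) \<Rightarrow> color \<Rightarrow> 'a::field" where
  "mutate_coords k \<epsilon> Z i =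
     (if i = k then inverse (Z k)
      else Z i * (1 + Z k powi (- sgn (\<epsilon> i k))) powi (- \<epsilon> i k))"

fun mutate :: "color \<Rightarrow> quiver \<times> (color \<Rightarrow> 'a) \<Rightarrow> quiver \<times> (color \<Rightarrow> 'a::field)" where
  "mutate k (\<epsilon>, Z) = (mutate_quiver k \<epsilon>, mutate_coords k \<epsilon> Z)"


section \<open>Rational functions in three variables\<close>

text \<open>The field of complex rational functions in three variables, as the fraction field of the
  iterated polynomial ring; the variables, from the innermost to the outermost ring, are those
  of the colors orange, blue and green.\<close>

type_synonym ratfun = "complex poly poly poly fract"

definition Const :: "complex \<Rightarrow> ratfun" where
  "Const c = to_fract [:[:[:c:]:]:]"

fun Var :: "color \<Rightarrow> ratfun" where
  "Var Orange = to_fract [:[:[:0, 1:]:]:]"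
| "Var Blue = to_fract [:[:0, 1:]:]"
| "Var Green = to_fract [:0, 1:]"

definition mutation_formula :: "triangulation \<Rightarrow> color list \<Rightarrow> color \<Rightarrow> ratfun" where
  "mutation_formula T ks = snd (fold mutate ks (quiver_of T, Var))"

text \<open>Substitution of \<open>F \<alpha>\<close> for the variable of color \<open>\<alpha>\<close>, as a complex algebra
  endomorphism of the field of rational functions.\<close>

definition is_substitution :: "(color \<Rightarrow> ratfun) \<Rightarrow> (ratfun \<Rightarrow> ratfun) \<Rightarrow> bool" where
  "is_substitution F \<sigma> \<longleftrightarrow>
     (\<forall>x y. \<sigma> (x + y) = \<sigma> x + \<sigma> y) \<and> (\<forall>x y. \<sigma> (x * y) = \<sigma> x * \<sigma> y) \<and>
     (\<forall>c. \<sigma> (Const c) = Const c) \<and> (\<forall>\<alpha>. \<sigma> (Var \<alpha>) = F \<alpha>)"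

end

theory Submission
  imports Defs
begin

text \<open>
  The coordinates are cross-ratios.  Attach to every pair of vertices of the hexagon a lambda length
  \<open>A u v\<close>, subject to Ptolemy's relation.  For a chord \<open>a c\<close> with surrounding quadrilateral
  \<open>a b c d\<close>, the cross-ratio \<open>A a b * A c d / (A b c * A d a)\<close> depends only on the triangulation, and
  a flip changes these cross-ratios exactly by the mutation.  So path independence follows once
  lambda lengths with prescribed cross-ratios on the initial triangulation are found.  On an
  equilateral triangulation they are explicit, and flips transport them to all the others, because
  mutations are involutive and preserve the positive rational functions (which excludes zero
  denominators).  The rotation formula is then read off from the explicit lambda lengths.
\<close>

section \<open>Triangulations of the hexagon\<close>

text \<open>Rescaling the lambda lengths by a factor for each vertex leaves all cross-ratios
  unchanged. This freedom is spent on a normal form in which the three edges left free are the three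
  prescribed coordinates. Path independence needs existence only: the lengths are chosen from the
  initial triangulation, and the final coordinates depend on them and on the final triangulation,
  not on the path between. The finite combinatorics reduces to nine configurations, because the
  flipped chord is rotated into one of two standard positions while the rotation stays a symbolic
  number. Division is total, so a vanishing denominator would silently break the identities;
  positivity is carried along to exclude it. A claim about all paths to the rotated triangulation
  says nothing unless there is one, so a path is exhibited. Finally, the existence of the field
  endomorphism is not automatic: three rational functions may be algebraically dependent, and
  substituting them can then annihilate a denominator.\<close>

lemma lessThan_6: "{..<6 :: nat} = {0, 1, 2, 3, 4, 5}"
  by auto

lemma hexagon_edges_eq: "hexagon_edges = {{0, 1}, {1, 2}, {2, 3}, {3, 4}, {4, 5}, {5, 0}}"
proof -
  have "hexagon_edges = (\<lambda>v. {v, (v + 1) mod 6}) ` {..<6}"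
    by (auto simp: hexagon_edges_def)
  also have "\<dots> = {{0, 1}, {1, 2}, {2, 3}, {3, 4}, {4, 5}, {5, 0}}"
    by code_simp
  finally show ?thesis .
qed

lemma diagonals_eq:
  "diagonals = {{0, 2}, {1, 3}, {2, 4}, {3, 5}, {4, 0}, {5, 1}, {0, 3}, {1, 4}, {2, 5}}"
proof -
  have "{{a, b} |a b. a < 6 \<and> b < 6 \<and> a \<noteq> b} = (\<Union>a\<in>{..<6}. \<Union>b\<in>{..<6} - {a}. {{a, b :: nat}})"
    by auto
  also have "\<dots> - hexagon_edges =
      {{0, 2}, {1, 3}, {2, 4}, {3, 5}, {4, 0}, {5, 1}, {0, 3}, {1, 4}, {2, 5}}"
    unfolding hexagon_edges_eq by code_simp
  finally show ?thesis
    by (simp add: diagonals_def)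
qed

section \<open>Crossing chords and the quadrilateral around a chord\<close>

lemma crossing_doubleton:
  "crossing {a, b} {c, d} \<longleftrightarrow> ccw a c b \<and> ccw b d a \<or> ccw a d b \<and> ccw b c a"
  by (force simp: crossing_def doubleton_eq_iff)

definition quad :: "triangulation \<Rightarrow> color \<Rightarrow> nat \<Rightarrow> nat \<Rightarrow> nat \<Rightarrow> nat \<Rightarrow> bool" where
  "quad T k a b c d \<longleftrightarrow>
     ccw a b c \<and> ccw a c d \<and> {{a, b}, {b, c}, {c, d}, {d, a}} \<subseteq> sides T \<and> T k = {a, c}"

lemma flip_iff_quad: "flip k T T' \<longleftrightarrow> (\<exists>a b c d. quad T k a b c d \<and> T' = T(k := {b, d}))"
  by (auto simp: flip_def quad_def)

lemma crossing_commute: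
  assumes "crossing x y"
  shows "crossing y x"
proof -
  obtain a b a' b' where "x = {a, b}" "y = {a', b'}" "ccw a a' b" "ccw b b' a"
    using assms by (auto simp: crossing_def)
  then have "ccw a' b b'" "ccw b' a a'"
    by (auto simp: ccw_def)
  then show ?thesis
    using \<open>x = {a, b}\<close> \<open>y = {a', b'}\<close>
    by (auto simp: crossing_doubleton)
qed

text \<open>No vertex lies strictly between the ends of an edge, so on one side of it there is no
  room for an end of a crossing chord. The bound on the ends of \<open>y\<close> rules out numbers
  beyond the six vertices.\<close>

lemma edge_not_crossing:
  assumes "x \<in> hexagon_edges" "\<And>v. v \<in> y \<Longrightarrow> v < 6"
  shows "\<not> crossing x y"
proof
  assume "crossing x y"
  then obtain a b a' b' where *: "x = {a, b}" "y = {a', b'}" "ccw a a' b" "ccw b b' a"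
    by (auto simp: crossing_def)
  then have "a' < 6" "b' < 6"
    using assms(2) by auto
  obtain v where "v < 6" "x = {v, (v + 1) mod 6}"
    using assms(1) by (auto simp: hexagon_edges_def)
  then have "a = v \<and> b = (v + 1) mod 6 \<or> b = v \<and> a = (v + 1) mod 6"
    using * by (auto simp: doubleton_eq_iff)
  moreover have "(v + 1) mod 6 = (if v = 5 then 0 else v + 1)"
    using \<open>v < 6\<close> by auto
  ultimately show False
    using * \<open>v < 6\<close> \<open>a' < 6\<close> \<open>b' < 6\<close> by (auto simp: ccw_def split: if_splits)
qed

lemma sides_vertex:
  assumes "colored_triangulation T" "x \<in> sides T" "v \<in> x"
  shows "v < 6"
proof -
  have "x \<in> hexagon_edges \<union> diagonals"
    using assms unfolding colored_triangulation_def sides_def by blast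
  then show ?thesis
    using \<open>v \<in> x\<close> by (auto simp: hexagon_edges_def diagonals_def)
qed

lemma sides_not_crossing:
  assumes "colored_triangulation T" "x \<in> sides T" "y \<in> sides T"
  shows "\<not> crossing x y"
  using assms edge_not_crossing[of x y] edge_not_crossing[of y x] sides_vertex[OF assms(1)]
    crossing_commute[of x y]
  unfolding colored_triangulation_def sides_def by blast

lemma ccw_rotate: "ccw a b c \<Longrightarrow> ccw b c a"
  by (auto simp: ccw_def)

text \<open>Both apexes lie on the same side of the segment from \<open>u\<close> to
  \<open>v\<close>. If they differed, the side from \<open>u\<close> to the apex farther from
  \<open>u\<close> would cross the side from the nearer apex to \<open>v\<close>.\<close>

lemma apex_unique:
  assumes "colored_triangulation T" "ccw u w v" "ccw u w' v"
    and "{u, w} \<in> sides T" "{w, v} \<in> sides T" "{u, w'} \<in> sides T" "{w', v} \<in> sides T"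
  shows "w = w'"
proof (rule ccontr)
  assume "w \<noteq> w'"
  then have "w < w' \<or> w' < w"
    by auto
  then have "ccw u w w' \<or> ccw u w' w"
    using assms(2,3) unfolding ccw_def by (elim disjE conjE; simp)
  then have "crossing {u, w'} {w, v} \<or> crossing {u, w} {w', v}"
    unfolding crossing_doubleton using assms(2,3) ccw_rotate by blast
  then show False
    using assms sides_not_crossing by blast
qed

text \<open>The chord fixes the pair \<open>a\<close>, \<open>c\<close>, and
  \<open>apex_unique\<close> fixes the corner on each side. The remaining freedom is the end from
  which the chord is read.\<close>

lemma quad_unique:
  assumes "colored_triangulation T" "quad T k a b c d" "quad T k p q r s"
  shows "p = a \<and> q = b \<and> r = c \<and> s = d \<or> p = c \<and> q = d \<and> r = a \<and> s = b"
proof -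
  have *: "{p, r} = {a, c}"
    using assms by (simp add: quad_def)
  then consider "p = a" "r = c" | "p = c" "r = a"
    by (auto simp: doubleton_eq_iff)
  then show ?thesis
  proof cases
    case 1
    then show ?thesis
      using assms apex_unique[OF assms(1), of a b c q] apex_unique[OF assms(1), of c d a s]
      by (simp add: quad_def ccw_rotate insert_commute)
  next
    case 2
    then show ?thesis
      using assms apex_unique[OF assms(1), of a b c s] apex_unique[OF assms(1), of c d a q]
      by (simp add: quad_def ccw_rotate insert_commute)
  qed
qed

section \<open>Rotated vertex labels and the configurations around a chord\<close>

lemma less_6_cases:
  assumes "(n :: nat) < 6"
  obtains "n = 0" | "n = 1" | "n = 2" | "n = 3" | "n = 4" | "n = 5"
  using assms by linarith

text \<open>Vertex labels counted from vertex \<open>n\<close>. The case checks are done on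
  \<open>rot n 0\<close>, ..., \<open>rot n 5\<close> for a symbolic \<open>n\<close>, which is how
  rotational symmetry enters them.\<close>

definition rot :: "nat \<Rightarrow> nat \<Rightarrow> nat" where
  "rot n m = (n + m) mod 6"

lemma rot_less [simp]: "rot n m < 6"
  by (simp add: rot_def)

lemma rot_less_6:
  assumes "n < 6" "a < 6"
  shows "rot n a = (if n + a < 6 then n + a else n + a - 6)"
  using assms by (simp add: rot_def mod_if)

lemma rot_mod_6: "rot (n mod 6) = rot n"
  by (simp add: rot_def fun_eq_iff mod_add_left_eq)

lemma rot_eq_iff [simp]:
  assumes "a < 6" "b < 6"
  shows "rot n a = rot n b \<longleftrightarrow> a = b"
proof -
  have "n mod 6 < 6"
    by simp
  then have "rot (n mod 6) a = rot (n mod 6) b \<longleftrightarrow> a = b"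
    using assms by (auto simp: rot_less_6 split: if_splits)
  then show ?thesis
    by (simp add: rot_mod_6)
qed

text \<open>The right side is \<open>ccw a b c\<close> unfolded, so that on numerals the simplifier
  decides it at once without unfolding \<open>ccw\<close> elsewhere.\<close>

lemma ccw_rot [simp]:
  assumes "a < 6" "b < 6" "c < 6"
  shows "ccw (rot n a) (rot n b) (rot n c) \<longleftrightarrow> a < b \<and> b < c \<or> b < c \<and> c < a \<or> c < a \<and> a < b"
proof -
  define m where "m = n mod 6"
  have "m < 6"
    by (simp add: m_def)
  have "ccw (rot m a) (rot m b) (rot m c) \<longleftrightarrow> ccw a b c"
    using assms \<open>m < 6\<close> unfolding ccw_def
    by (cases "m + a < 6"; cases "m + b < 6"; cases "m + c < 6"; simp add: rot_less_6; arith)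
  then show ?thesis
    by (simp add: rot_mod_6 ccw_def m_def)
qed

lemma hexagon_edges_rot:
  "hexagon_edges = {{rot n 0, rot n 1}, {rot n 1, rot n 2}, {rot n 2, rot n 3}, {rot n 3, rot n 4},
     {rot n 4, rot n 5}, {rot n 5, rot n 0}}"
proof -
  have "n mod 6 < 6"
    by simp
  then show ?thesis
    unfolding rot_mod_6[of n, symmetric] hexagon_edges_eq
    by (cases rule: less_6_cases) (simp_all add: rot_def insert_commute flip: numeral_2_eq_2 del: One_nat_def)
qed

lemma diagonals_rot:
  "diagonals = {{rot n 0, rot n 2}, {rot n 1, rot n 3}, {rot n 2, rot n 4}, {rot n 3, rot n 5},
     {rot n 4, rot n 0}, {rot n 5, rot n 1}, {rot n 0, rot n 3}, {rot n 1, rot n 4}, {rot n 2, rot n 5}}"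
proof -
  have "n mod 6 < 6"
    by simp
  then show ?thesis
    unfolding rot_mod_6[of n, symmetric] diagonals_eq
    by (cases rule: less_6_cases) (simp_all add: rot_def insert_commute flip: numeral_2_eq_2 del: One_nat_def)
qed

text \<open>The triangulations containing a given chord \<open>x\<close>, up to a rotation taking \<open>x\<close> to
  \<open>{0, 2}\<close> or \<open>{0, 3}\<close>.\<close>

definition configs :: "nat \<Rightarrow> (nat set \<times> nat set \<times> nat set) set" where
  "configs n = (let r = rot n in
     {({r 0, r 2}, {r 0, r 3}, {r 0, r 4}), ({r 0, r 2}, {r 0, r 3}, {r 3, r 5}),
      ({r 0, r 2}, {r 0, r 4}, {r 2, r 4}), ({r 0, r 2}, {r 2, r 4}, {r 2, r 5}),
      ({r 0, r 2}, {r 2, r 5}, {r 3, r 5}), ({r 0, r 3}, {r 0, r 2}, {r 0, r 4}),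
      ({r 0, r 3}, {r 0, r 2}, {r 3, r 5}), ({r 0, r 3}, {r 1, r 3}, {r 0, r 4}),
      ({r 0, r 3}, {r 1, r 3}, {r 3, r 5})})"

lemma diagonal_rot:
  assumes "x \<in> diagonals"
  obtains n where "x = {rot n 0, rot n 2} \<or> x = {rot n 0, rot n 3}"
proof -
  have "\<exists>n\<in>{..<6}. x = {rot n 0, rot n 2} \<or> x = {rot n 0, rot n 3}"
    using assms unfolding diagonals_eq lessThan_6
    by (elim insertE emptyE; simp add: rot_def doubleton_eq_iff)
  then show ?thesis
    using that by auto
qed

text \<open>A short chord cuts the hexagon into a triangle and a pentagon; the listed chords are the
  five diagonals of the pentagon.\<close>

lemma noncrossing_short:
  assumes "y \<in> diagonals" "{rot n 0, rot n 2} \<noteq> y" "\<not> crossing {rot n 0, rot n 2} y"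
  shows "y \<in> {{rot n 0, rot n 3}, {rot n 0, rot n 4}, {rot n 2, rot n 4}, {rot n 2, rot n 5},
    {rot n 3, rot n 5}}"
  using assms unfolding diagonals_rot[of n]
  by (elim insertE emptyE; hypsubst; simp add: crossing_doubleton doubleton_eq_iff)

text \<open>A long chord cuts the hexagon into two quadrilaterals with two diagonals each.\<close>

lemma noncrossing_long:
  assumes "y \<in> diagonals" "{rot n 0, rot n 3} \<noteq> y" "\<not> crossing {rot n 0, rot n 3} y"
  shows "y \<in> {{rot n 0, rot n 2}, {rot n 1, rot n 3}, {rot n 0, rot n 4}, {rot n 3, rot n 5}}"
  using assms unfolding diagonals_rot[of n]
  by (elim insertE emptyE; hypsubst; simp add: crossing_doubleton doubleton_eq_iff)

lemma noncrossing_configs: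
  assumes "x \<in> diagonals" "y \<in> diagonals" "z \<in> diagonals" "x \<noteq> y" "x \<noteq> z" "y \<noteq> z"
    and "\<not> crossing x y" "\<not> crossing x z" "\<not> crossing y z"
  obtains n where "(x, y, z) \<in> configs n \<or> (x, z, y) \<in> configs n"
proof -
  obtain n where n: "x = {rot n 0, rot n 2} \<or> x = {rot n 0, rot n 3}"
    using diagonal_rot[OF assms(1)] .
  then have "(x, y, z) \<in> configs n \<or> (x, z, y) \<in> configs n"
  proof
    assume x: "x = {rot n 0, rot n 2}"
    have y: "y \<in> {{rot n 0, rot n 3}, {rot n 0, rot n 4}, {rot n 2, rot n 4}, {rot n 2, rot n 5},
        {rot n 3, rot n 5}}"
      using assms by (intro noncrossing_short) (simp_all add: x)
    have z: "z \<in> {{rot n 0, rot n 3}, {rot n 0, rot n 4}, {rot n 2, rot n 4}, {rot n 2, rot n 5},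
        {rot n 3, rot n 5}}"
      using assms by (intro noncrossing_short) (simp_all add: x)
    show ?thesis
      using y z assms(6,9) unfolding x
      by (elim insertE emptyE; hypsubst;
          simp add: configs_def Let_def crossing_doubleton doubleton_eq_iff)
  next
    assume x: "x = {rot n 0, rot n 3}"
    have y: "y \<in> {{rot n 0, rot n 2}, {rot n 1, rot n 3}, {rot n 0, rot n 4}, {rot n 3, rot n 5}}"
      using assms by (intro noncrossing_long) (simp_all add: x)
    have z: "z \<in> {{rot n 0, rot n 2}, {rot n 1, rot n 3}, {rot n 0, rot n 4}, {rot n 3, rot n 5}}"
      using assms by (intro noncrossing_long) (simp_all add: x)
    show ?thesis
      using y z assms(6,9) unfolding x
      by (elim insertE emptyE; hypsubst;
          simp add: configs_def Let_def crossing_doubleton doubleton_eq_iff)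
  qed
  then show ?thesis
    using that by blast
qed

text \<open>The color \<open>k\<close> is arbitrary and is going to be the flipped one. The freedom
  to exchange \<open>i\<close> and \<open>j\<close> absorbs the order of the other two
  chords.\<close>

lemma colored_triangulation_configs:
  assumes "colored_triangulation T"
  obtains n i j where "UNIV = {k, i, j}" "distinct [k, i, j]" "(T k, T i, T j) \<in> configs n"
proof -
  obtain i j where ij: "UNIV = {k, i, j}" "distinct [k, i, j]"
  proof (cases k)
    case Orange
    then show ?thesis
      using that[of Blue Green] by (auto intro: color.exhaust)
  next
    case Blue
    then show ?thesis
      using that[of Orange Green] by (auto intro: color.exhaust)
  next
    case Green
    then show ?thesis
      using that[of Orange Blue] by (auto intro: color.exhaust)
  qed
  have T: "inj T" "\<And>x. T x \<in> diagonals" "\<And>x y. \<not> crossing (T x) (T y)"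
    using assms by (auto simp: colored_triangulation_def)
  have "T k \<noteq> T i" "T k \<noteq> T j" "T i \<noteq> T j"
    using ij(2) T(1) by (simp_all add: inj_eq)
  then obtain n where "(T k, T i, T j) \<in> configs n \<or> (T k, T j, T i) \<in> configs n"
    using noncrossing_configs[of "T k" "T i" "T j"] T by blast
  moreover have "UNIV = {k, j, i}" "distinct [k, j, i]"
    using ij by auto
  ultimately show ?thesis
    using that ij by blast
qed

section \<open>Flips and cross-ratios\<close>

text \<open>Arrows in terms of explicit vertex sets instead of a triangulation, so that they can be
  computed in a fixed configuration.\<close>

definition chord_arrows :: "nat set set \<Rightarrow> nat set \<Rightarrow> nat set \<Rightarrow> (nat \<times> nat \<times> nat) set" where
  "chord_arrows S x y = {(a, b, c). ccw a b c \<and> {{a, b}, {b, c}, {c, a}} \<subseteq> S \<and> x = {a, b} \<and> y = {b, c}}"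

definition chord_quiver :: "nat set set \<Rightarrow> nat set \<Rightarrow> nat set \<Rightarrow> int" where
  "chord_quiver S x y = int (card (chord_arrows S x y)) - int (card (chord_arrows S y x))"

lemma quiver_of_eq: "quiver_of T i j = chord_quiver (sides T) (T i) (T j)"
  by (simp add: quiver_of_def arrows_def chord_quiver_def chord_arrows_def)

text \<open>Two different chords share at most one vertex, which has to be the middle one of the
  triple, so there is at most one arrow. The four summands are the four ways in which the ends can
  coincide.\<close>

lemma card_chord_arrows:
  assumes "{u, v} \<in> S" "{x, y} \<in> S" "u \<noteq> v" "x \<noteq> y" "{u, v} \<noteq> {x, y}"
  shows "int (card (chord_arrows S {u, v} {x, y})) =
      of_bool (v = x \<and> ccw u v y \<and> {y, u} \<in> S) + of_bool (v = y \<and> ccw u v x \<and> {x, u} \<in> S) +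
      of_bool (u = x \<and> ccw v u y \<and> {y, v} \<in> S) + of_bool (u = y \<and> ccw v u x \<and> {x, v} \<in> S)"
proof -
  have S: "{v, u} \<in> S" "{y, x} \<in> S"
    using assms(1,2) by (simp_all add: insert_commute)
  consider "v = x" | "v = y" | "u = x" | "u = y" | "{u, v} \<inter> {x, y} = {}"
    by blast
  then show ?thesis
  proof cases
    case 1
    then have "chord_arrows S {u, v} {x, y} = (if ccw u v y \<and> {y, u} \<in> S then {(u, v, y)} else {})"
      using assms S by (auto simp: chord_arrows_def doubleton_eq_iff)
    then show ?thesis
      using 1 assms by (auto simp: doubleton_eq_iff)
  next
    case 2
    then have "chord_arrows S {u, v} {x, y} = (if ccw u v x \<and> {x, u} \<in> S then {(u, v, x)} else {})"
      using assms S by (auto simp: chord_arrows_def doubleton_eq_iff)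
    then show ?thesis
      using 2 assms by (auto simp: doubleton_eq_iff)
  next
    case 3
    then have "chord_arrows S {u, v} {x, y} = (if ccw v u y \<and> {y, v} \<in> S then {(v, u, y)} else {})"
      using assms S by (auto simp: chord_arrows_def doubleton_eq_iff)
    then show ?thesis
      using 3 assms by (auto simp: doubleton_eq_iff)
  next
    case 4
    then have "chord_arrows S {u, v} {x, y} = (if ccw v u x \<and> {x, v} \<in> S then {(v, u, x)} else {})"
      using assms S by (auto simp: chord_arrows_def doubleton_eq_iff)
    then show ?thesis
      using 4 assms by (auto simp: doubleton_eq_iff)
  next
    case 5
    then have "chord_arrows S {u, v} {x, y} = {}"
      using assms S by (auto simp: chord_arrows_def doubleton_eq_iff)
    then show ?thesis
      using 5 assms by auto
  qed
qed

lemma chord_quiver_doubleton: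
  assumes "{u, v} \<in> S" "{x, y} \<in> S" "u \<noteq> v" "x \<noteq> y" "{u, v} \<noteq> {x, y}"
  shows "chord_quiver S {u, v} {x, y} =
    (if v = x then (if {y, u} \<in> S then of_bool (ccw u v y) - of_bool (ccw y v u) else 0)
     else if v = y then (if {x, u} \<in> S then of_bool (ccw u v x) - of_bool (ccw x v u) else 0)
     else if u = x then (if {y, v} \<in> S then of_bool (ccw v u y) - of_bool (ccw y u v) else 0)
     else if u = y then (if {x, v} \<in> S then of_bool (ccw v u x) - of_bool (ccw x u v) else 0)
     else 0)"
  unfolding chord_quiver_def card_chord_arrows[OF assms]
    card_chord_arrows[OF assms(2,1,4,3) assms(5)[symmetric]]
  using assms(3-5)
  by (cases "v = x"; cases "v = y"; cases "u = x"; cases "u = y")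
    (simp_all add: insert_commute[of u x "{}"] insert_commute[of u y "{}"] insert_commute[of v x "{}"]
      insert_commute[of v y "{}"])

section \<open>Cross-ratios and their change under a flip\<close>

lemma quiver_of_self [simp]: "quiver_of T i i = 0"
  by (simp add: quiver_of_def)

lemma quiver_of_commute: "quiver_of T j i = - quiver_of T i j"
  by (simp add: quiver_of_def)

definition coords :: "(nat \<Rightarrow> nat \<Rightarrow> 'a::field) \<Rightarrow> triangulation \<Rightarrow> color \<Rightarrow> 'a" where
  "coords A T \<alpha> = (THE z. \<exists>a b c d. quad T \<alpha> a b c d \<and> z = A a b * A c d / (A b c * A d a))"

text \<open>Reading the quadrilateral from \<open>c\<close> instead of \<open>a\<close> only
  permutes the factors within numerator and denominator, so the description in \<open>coords\<close>
  picks out one value.\<close>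

lemma coords_quad:
  assumes "colored_triangulation T" "quad T \<alpha> a b c d"
  shows "coords A T \<alpha> = A a b * A c d / (A b c * A d a)"
  unfolding coords_def
proof (rule the_equality)
  show "\<exists>p q r s. quad T \<alpha> p q r s \<and> A a b * A c d / (A b c * A d a) = A p q * A r s / (A q r * A s p)"
    using assms(2) by blast
next
  fix z
  assume "\<exists>p q r s. quad T \<alpha> p q r s \<and> z = A p q * A r s / (A q r * A s p)"
  then show "z = A a b * A c d / (A b c * A d a)"
    by (elim exE conjE) (use quad_unique[OF assms] in \<open>fastforce simp: mult.commute\<close>)
qed

text \<open>The chord \<open>i\<close> is one of the sides \<open>a b\<close>, \<open>b c\<close>, \<open>c d\<close>, \<open>d a\<close> of the quadrilateral in which \<open>k\<close> is
  flipped, with \<open>e\<close> the apex of the triangle on its other side, or none of them.\<close>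

definition flip_link :: "triangulation \<Rightarrow> color \<Rightarrow> nat \<Rightarrow> nat \<Rightarrow> nat \<Rightarrow> nat \<Rightarrow> color \<Rightarrow> bool" where
  "flip_link T k a b c d i \<longleftrightarrow> (let T' = T(k := {b, d}) in
     quiver_of T i k = - 1 \<and> (\<exists>e. quad T i a e b c \<and> quad T' i a e b d) \<or>
     quiver_of T i k = 1 \<and> (\<exists>e. quad T i b e c a \<and> quad T' i b e c d) \<or>
     quiver_of T i k = - 1 \<and> (\<exists>e. quad T i c e d a \<and> quad T' i c e d b) \<or>
     quiver_of T i k = 1 \<and> (\<exists>e. quad T i d e a c \<and> quad T' i d e a b) \<or>
     quiver_of T i k = 0 \<and> (\<exists>p q r s. quad T i p q r s \<and> quad T' i p q r s))"

lemma flip_linkI: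
  "quiver_of T i k = - 1 \<Longrightarrow> quad T i a e b c \<Longrightarrow> quad (T(k := {b, d})) i a e b d \<Longrightarrow> flip_link T k a b c d i"
  "quiver_of T i k = 1 \<Longrightarrow> quad T i b e c a \<Longrightarrow> quad (T(k := {b, d})) i b e c d \<Longrightarrow> flip_link T k a b c d i"
  "quiver_of T i k = - 1 \<Longrightarrow> quad T i c e d a \<Longrightarrow> quad (T(k := {b, d})) i c e d b \<Longrightarrow> flip_link T k a b c d i"
  "quiver_of T i k = 1 \<Longrightarrow> quad T i d e a c \<Longrightarrow> quad (T(k := {b, d})) i d e a b \<Longrightarrow> flip_link T k a b c d i"
  "quiver_of T i k = 0 \<Longrightarrow> quad T i p q r s \<Longrightarrow> quad (T(k := {b, d})) i p q r s \<Longrightarrow> flip_link T k a b c d i"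
  unfolding flip_link_def Let_def by blast+

locale lambda_lengths =
  fixes A :: "nat \<Rightarrow> nat \<Rightarrow> 'a::field"
  assumes commute: "A u v = A v u"
    and nonzero: "u < 6 \<Longrightarrow> v < 6 \<Longrightarrow> u \<noteq> v \<Longrightarrow> A u v \<noteq> 0"
    and ptolemy: "{a, b, c, d} \<subseteq> {..<6} \<Longrightarrow> ccw a b c \<Longrightarrow> ccw a c d \<Longrightarrow>
      A a c * A b d = A a b * A c d + A b c * A d a"

lemma quad_vertices:
  assumes "colored_triangulation T" "quad T k a b c d"
  shows "{a, b, c, d} \<subseteq> {..<6}"
  using assms(2) sides_vertex[OF assms(1), of "{a, b}"] sides_vertex[OF assms(1), of "{c, d}"]
  by (auto simp: quad_def)

lemma quad_distinct: "quad T k a b c d \<Longrightarrow> distinct [a, b, c, d]"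
  by (auto simp: quad_def ccw_def)

lemma (in lambda_lengths) quad_nonzero:
  assumes "colored_triangulation T" "quad T k a b c d"
  shows "A a b \<noteq> 0" "A b c \<noteq> 0" "A c d \<noteq> 0" "A d a \<noteq> 0" "A a c \<noteq> 0" "A b d \<noteq> 0"
  using quad_vertices[OF assms] quad_distinct[OF assms(2)] by (auto simp: nonzero)

text \<open>Ptolemy's relation, divided by either product of opposite sides. The two equations serve
  the two signs of the exponent in \<open>mutate_coords\<close>.\<close>

lemma (in lambda_lengths) one_plus_coords:
  assumes "colored_triangulation T" "quad T k a b c d"
  shows "1 + coords A T k = A a c * A b d / (A b c * A d a)"
    and "1 + inverse (coords A T k) = A a c * A b d / (A a b * A c d)"
proof -
  have "A a c * A b d = A a b * A c d + A b c * A d a"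
    using ptolemy quad_vertices[OF assms] assms(2) by (simp add: quad_def)
  then show "1 + coords A T k = A a c * A b d / (A b c * A d a)"
    and "1 + inverse (coords A T k) = A a c * A b d / (A a b * A c d)"
    using quad_nonzero[OF assms] unfolding coords_quad[OF assms] by (simp_all add: field_simps)
qed

text \<open>If \<open>i\<close> is a side of the quadrilateral of \<open>k\<close>, the flip
  replaces just one corner of the quadrilateral of \<open>i\<close>. The new cross-ratio divided by
  the old one is then \<open>A a c * A b d\<close> over a product of opposite sides, or the inverse
  of such a quotient, which \<open>one_plus_coords\<close> identifies with the factor in the
  mutation.\<close>

lemma (in lambda_lengths) mutate_coords_flip_link:
  assumes T: "colored_triangulation T" and T': "colored_triangulation (T(k := {b, d}))"
    and "i \<noteq> k" and k: "quad T k a b c d" and link: "flip_link T k a b c d i"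
  shows "coords A (T(k := {b, d})) i = mutate_coords k (quiver_of T) (coords A T) i"
proof -
  let ?T' = "T(k := {b, d})"
  note nz = quad_nonzero[OF T] quad_nonzero[OF T']
  consider (ab) e where "quiver_of T i k = - 1" "quad T i a e b c" "quad ?T' i a e b d"
    | (bc) e where "quiver_of T i k = 1" "quad T i b e c a" "quad ?T' i b e c d"
    | (cd) e where "quiver_of T i k = - 1" "quad T i c e d a" "quad ?T' i c e d b"
    | (da) e where "quiver_of T i k = 1" "quad T i d e a c" "quad ?T' i d e a b"
    | (none) p q r s where "quiver_of T i k = 0" "quad T i p q r s" "quad ?T' i p q r s"
    using link unfolding flip_link_def Let_def by blast
  then show ?thesis
  proof cases
    case ab
    have "mutate_coords k (quiver_of T) (coords A T) i =
        A a e * A b c / (A e b * A c a) * (A a c * A b d / (A b c * A d a))"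
      using ab(1) \<open>i \<noteq> k\<close> one_plus_coords[OF T k] coords_quad[OF T ab(2), of A]
      by (simp add: mutate_coords_def)
    then show ?thesis
      using coords_quad[OF T' ab(3), of A] quad_nonzero[OF T k] commute[of a c] by simp
  next
    case bc
    have "mutate_coords k (quiver_of T) (coords A T) i =
        A b e * A c a / (A e c * A a b) * inverse (A a c * A b d / (A a b * A c d))"
      using bc(1) \<open>i \<noteq> k\<close> one_plus_coords[OF T k] coords_quad[OF T bc(2), of A]
      by (simp add: mutate_coords_def power_int_minus)
    then show ?thesis
      using coords_quad[OF T' bc(3), of A] quad_nonzero[OF T k] commute[of a c] commute[of b d]
      by (simp add: field_simps)
  next
    case cd
    have "mutate_coords k (quiver_of T) (coords A T) i =
        A c e * A d a / (A e d * A a c) * (A a c * A b d / (A b c * A d a))"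
      using cd(1) \<open>i \<noteq> k\<close> one_plus_coords[OF T k] coords_quad[OF T cd(2), of A]
      by (simp add: mutate_coords_def)
    then show ?thesis
      using coords_quad[OF T' cd(3), of A] quad_nonzero[OF T k] commute[of b d] by simp
  next
    case da
    have "mutate_coords k (quiver_of T) (coords A T) i =
        A d e * A a c / (A e a * A c d) * inverse (A a c * A b d / (A a b * A c d))"
      using da(1) \<open>i \<noteq> k\<close> one_plus_coords[OF T k] coords_quad[OF T da(2), of A]
      by (simp add: mutate_coords_def power_int_minus)
    then show ?thesis
      using coords_quad[OF T' da(3), of A] quad_nonzero[OF T k]
      by (simp add: field_simps)
  next
    case none
    then show ?thesis
      using \<open>i \<noteq> k\<close> coords_quad[OF T none(2), of A] coords_quad[OF T' none(3), of A]
      by (simp add: mutate_coords_def)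
  qed
qed

section \<open>The case check for all flips\<close>

lemma triangulation_sides:
  assumes "UNIV = {k, i, j}"
  shows "sides T = hexagon_edges \<union> {T k, T i, T j}"
  by (simp add: sides_def assms)

definition flip_local :: "triangulation \<Rightarrow> color \<Rightarrow> nat \<Rightarrow> nat \<Rightarrow> nat \<Rightarrow> nat \<Rightarrow> bool" where
  "flip_local T k a b c d \<longleftrightarrow> quad T k a b c d \<and> colored_triangulation (T(k := {b, d})) \<and>
     quiver_of (T(k := {b, d})) = mutate_quiver k (quiver_of T) \<and>
     (\<forall>i. i \<noteq> k \<longrightarrow> flip_link T k a b c d i)"

text \<open>Signed arrow counts are antisymmetric, also after mutation, so one entry for each pair
  of colors suffices.\<close>

lemma mutate_quiver_eqI:
  assumes "UNIV = {k, i, j}" "distinct [k, i, j]"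
    and "quiver_of T' i k = - quiver_of T i k" "quiver_of T' j k = - quiver_of T j k"
    and "quiver_of T' i j = mutate_quiver k (quiver_of T) i j"
  shows "quiver_of T' = mutate_quiver k (quiver_of T)"
proof (intro ext)
  fix x y
  have "x = k \<or> x = i \<or> x = j" "y = k \<or> y = i \<or> y = j"
    using assms(1) by auto
  then show "quiver_of T' x y = mutate_quiver k (quiver_of T) x y"
    using assms(2-)
    by (elim disjE; simp add: mutate_quiver_def quiver_of_commute[of T' k] quiver_of_commute[of T' j i]
        quiver_of_commute[of T k] quiver_of_commute[of T j i])
qed

lemma colored_triangulationI:
  assumes "UNIV = {k, i, j}" "T k \<in> diagonals" "T i \<in> diagonals" "T j \<in> diagonals"
    and "T k \<noteq> T i" "T k \<noteq> T j" "T i \<noteq> T j"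
    and "\<not> crossing (T k) (T i)" "\<not> crossing (T k) (T j)" "\<not> crossing (T i) (T j)"
  shows "colored_triangulation T"
proof -
  have *: "x \<in> {k, i, j}" for x
    using assms(1) by blast
  have "x = y" if "T x = T y" for x y
    using *[of x] *[of y] that assms(5-7) by auto
  moreover have "T x \<in> diagonals" for x
    using *[of x] assms(2-4) by auto
  moreover have "\<not> crossing (T x) (T x)" for x
    by (auto simp: crossing_def ccw_def doubleton_eq_iff)
  then have "\<not> crossing (T x) (T y)" for x y
    using *[of x] *[of y] assms(8-10) crossing_commute by auto
  ultimately show ?thesis
    by (auto simp: colored_triangulation_def inj_def)
qed

lemma flip_localI:
  assumes "UNIV = {k, i, j}" "distinct [k, i, j]" "quad T k a b c d"
    and "colored_triangulation (T(k := {b, d}))" "flip_link T k a b c d i" "flip_link T k a b c d j"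
    and "quiver_of (T(k := {b, d})) i k = - quiver_of T i k"
    and "quiver_of (T(k := {b, d})) j k = - quiver_of T j k"
    and "quiver_of (T(k := {b, d})) i j = mutate_quiver k (quiver_of T) i j"
  shows "flip_local T k a b c d"
proof -
  have "x = k \<or> x = i \<or> x = j" for x
    using assms(1) by auto
  then show ?thesis
    using assms(3-6) mutate_quiver_eqI[OF assms(1,2,7-9)] unfolding flip_local_def by metis
qed

text \<open>One quadrilateral for each configuration is enough: \<open>flip_obtain_local\<close>
  compares it with that of a given flip by \<open>quad_unique\<close>.\<close>

lemma flip_local_exists:
  assumes "colored_triangulation T"
  shows "\<exists>a b c d. flip_local T k a b c d"
proof -
  obtain n i j where ij: "UNIV = {k, i, j}" "distinct [k, i, j]" and T: "(T k, T i, T j) \<in> configs n"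
    using colored_triangulation_configs[OF assms] .
  have ne: "i \<noteq> k" "j \<noteq> k" "k \<noteq> i" "k \<noteq> j" "i \<noteq> j" "j \<noteq> i"
    using ij(2) by auto
  let ?r = "rot n"
  note local_simps = mutate_quiver_def quad_def triangulation_sides[OF ij(1)] hexagon_edges_rot[of n]
    quiver_of_eq chord_quiver_doubleton doubleton_eq_iff crossing_doubleton diagonals_rot[of n]
  note intros = flip_localI[OF ij] colored_triangulationI[OF ij(1)]
  consider
    (1) "T k = {?r 0, ?r 2}" "T i = {?r 0, ?r 3}" "T j = {?r 0, ?r 4}"
    | (2) "T k = {?r 0, ?r 2}" "T i = {?r 0, ?r 3}" "T j = {?r 3, ?r 5}"
    | (3) "T k = {?r 0, ?r 2}" "T i = {?r 0, ?r 4}" "T j = {?r 2, ?r 4}"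
    | (4) "T k = {?r 0, ?r 2}" "T i = {?r 2, ?r 4}" "T j = {?r 2, ?r 5}"
    | (5) "T k = {?r 0, ?r 2}" "T i = {?r 2, ?r 5}" "T j = {?r 3, ?r 5}"
    | (6) "T k = {?r 0, ?r 3}" "T i = {?r 0, ?r 2}" "T j = {?r 0, ?r 4}"
    | (7) "T k = {?r 0, ?r 3}" "T i = {?r 0, ?r 2}" "T j = {?r 3, ?r 5}"
    | (8) "T k = {?r 0, ?r 3}" "T i = {?r 1, ?r 3}" "T j = {?r 0, ?r 4}"
    | (9) "T k = {?r 0, ?r 3}" "T i = {?r 1, ?r 3}" "T j = {?r 3, ?r 5}"
    using T unfolding configs_def Let_def insert_iff empty_iff prod.inject by meson
  then show ?thesis
  proof cases
    case 1
    \<comment> \<open>In all nine cases the number of the rule from \<open>flip_linkI\<close> tells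
      where the other chord lies: 1 to 4 for the sides \<open>a b\<close>, \<open>b c\<close>,
      \<open>c d\<close>, \<open>d a\<close>, and 5 for none of them.\<close>
    then have "flip_local T k (?r 0) (?r 1) (?r 2) (?r 3)"
      using ne
      by (intro intros flip_linkI(4)[where e = "?r 4" and T = T and i = i and k = k]
          flip_linkI(5)[where p = "?r 0" and q = "?r 3" and r = "?r 4" and s = "?r 5"
            and T = T and i = j and k = k]; simp add: local_simps)
    then show ?thesis
      by blast
  next
    case 2
    then have "flip_local T k (?r 0) (?r 1) (?r 2) (?r 3)"
      using ne
      by (intro intros flip_linkI(4)[where e = "?r 5" and T = T and i = i and k = k]
          flip_linkI(5)[where p = "?r 3" and q = "?r 4" and r = "?r 5" and s = "?r 0"
            and T = T and i = j and k = k]; simp add: local_simps)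
    then show ?thesis
      by blast
  next
    case 3
    then have "flip_local T k (?r 0) (?r 1) (?r 2) (?r 4)"
      using ne
      by (intro intros flip_linkI(4)[where e = "?r 5" and T = T and i = i and k = k]
          flip_linkI(3)[where e = "?r 3"
            and T = T and i = j and k = k]; simp add: local_simps)
    then show ?thesis
      by blast
  next
    case 4
    then have "flip_local T k (?r 0) (?r 1) (?r 2) (?r 5)"
      using ne
      by (intro intros flip_linkI(5)[where p = "?r 2" and q = "?r 3" and r = "?r 4" and s = "?r 5"
            and T = T and i = i and k = k]
          flip_linkI(3)[where e = "?r 4"
            and T = T and i = j and k = k]; simp add: local_simps)
    then show ?thesis
      by blast
  next
    case 5
    then have "flip_local T k (?r 0) (?r 1) (?r 2) (?r 5)"
      using ne
      by (intro intros flip_linkI(3)[where e = "?r 3" and T = T and i = i and k = k]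
          flip_linkI(5)[where p = "?r 3" and q = "?r 4" and r = "?r 5" and s = "?r 2"
            and T = T and i = j and k = k]; simp add: local_simps)
    then show ?thesis
      by blast
  next
    case 6
    then have "flip_local T k (?r 0) (?r 2) (?r 3) (?r 4)"
      using ne
      by (intro intros flip_linkI(1)[where e = "?r 1" and T = T and i = i and k = k]
          flip_linkI(4)[where e = "?r 5"
            and T = T and i = j and k = k]; simp add: local_simps)
    then show ?thesis
      by blast
  next
    case 7
    then have "flip_local T k (?r 0) (?r 2) (?r 3) (?r 5)"
      using ne
      by (intro intros flip_linkI(1)[where e = "?r 1" and T = T and i = i and k = k]
          flip_linkI(3)[where e = "?r 4"
            and T = T and i = j and k = k]; simp add: local_simps)
    then show ?thesis
      by blast
  next
    case 8
    then have "flip_local T k (?r 0) (?r 1) (?r 3) (?r 4)"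
      using ne
      by (intro intros flip_linkI(2)[where e = "?r 2" and T = T and i = i and k = k]
          flip_linkI(4)[where e = "?r 5"
            and T = T and i = j and k = k]; simp add: local_simps)
    then show ?thesis
      by blast
  next
    case 9
    then have "flip_local T k (?r 0) (?r 1) (?r 3) (?r 5)"
      using ne
      by (intro intros flip_linkI(2)[where e = "?r 2" and T = T and i = i and k = k]
          flip_linkI(3)[where e = "?r 4"
            and T = T and i = j and k = k]; simp add: local_simps)
    then show ?thesis
      by blast
  qed
qed

text \<open>None of the four sides is the flipped chord, so all of them survive. Reading the
  quadrilateral from \<open>b\<close> makes the flip reversible and turns the cross-ratio into its
  inverse.\<close>

lemma quad_flip:
  assumes "quad T k a b c d"
  shows "quad (T(k := {b, d})) k b c d a"
proof -
  have ne: "{b, c} \<noteq> {a, c}" "{c, d} \<noteq> {a, c}" "{d, a} \<noteq> {a, c}" "{a, b} \<noteq> {a, c}"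
    using quad_distinct[OF assms] by (auto simp: doubleton_eq_iff)
  have "x \<in> sides (T(k := {b, d}))" if "x \<in> sides T" "x \<noteq> {a, c}" for x
    using that assms by (auto simp: sides_def quad_def)
  then have "{{b, c}, {c, d}, {d, a}, {a, b}} \<subseteq> sides (T(k := {b, d}))"
    using assms ne by (simp add: quad_def)
  moreover have "ccw b c d" "ccw b d a"
    using assms unfolding quad_def ccw_def by linarith+
  ultimately show ?thesis
    by (simp add: quad_def)
qed

lemma flip_commute:
  assumes "flip k T T'"
  shows "flip k T' T"
proof -
  obtain a b c d where q: "quad T k a b c d" and T': "T' = T(k := {b, d})"
    using assms unfolding flip_iff_quad by blast
  then have "T = T'(k := {c, a})"
    by (auto simp: quad_def insert_commute fun_eq_iff)
  moreover have "quad T' k b c d a"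
    using quad_flip[OF q] T' by simp
  ultimately show ?thesis
    unfolding flip_iff_quad by metis
qed

lemma flip_obtain_local:
  assumes "colored_triangulation T" "flip k T T'"
  obtains a b c d where "flip_local T k a b c d" "T' = T(k := {b, d})"
proof -
  obtain a b c d where abcd: "flip_local T k a b c d"
    using flip_local_exists[OF assms(1)] by blast
  obtain p q r s where "quad T k p q r s" "T' = T(k := {q, s})"
    using assms(2) unfolding flip_iff_quad by blast
  then have "T' = T(k := {b, d})"
    using quad_unique[OF assms(1)] abcd unfolding flip_local_def by (metis insert_commute)
  then show ?thesis
    using that abcd by blast
qed

lemma flip_colored_triangulation: "colored_triangulation T \<Longrightarrow> flip k T T' \<Longrightarrow> colored_triangulation T'"
  by (erule flip_obtain_local) (auto simp: flip_local_def)

lemma flip_quiver_of: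
  "colored_triangulation T \<Longrightarrow> flip k T T' \<Longrightarrow> quiver_of T' = mutate_quiver k (quiver_of T)"
  by (erule flip_obtain_local) (auto simp: flip_local_def)

lemma (in lambda_lengths) flip_coords:
  assumes "colored_triangulation T" "flip k T T'"
  shows "coords A T' = mutate_coords k (quiver_of T) (coords A T)"
proof
  fix i
  obtain a b c d where l: "flip_local T k a b c d" and T': "T' = T(k := {b, d})"
    using flip_obtain_local[OF assms] .
  then have q: "quad T k a b c d" and col: "colored_triangulation T'"
    by (auto simp: flip_local_def)
  show "coords A T' i = mutate_coords k (quiver_of T) (coords A T) i"
  proof (cases "i = k")
    case True
    have "quad T' k b c d a"
      using quad_flip[OF q] T' by simp
    then show ?thesis
      using True coords_quad[OF col, of k b c d a A] coords_quad[OF assms(1) q, of A]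
      by (simp add: mutate_coords_def mult.commute)
  next
    case False
    then show ?thesis
      using mutate_coords_flip_link[OF assms(1) _ False q] l col T' by (simp add: flip_local_def)
  qed
qed

lemma (in lambda_lengths) flip_path_coords:
  assumes "flip_path T p T'" "colored_triangulation T"
  shows "fold mutate p (quiver_of T, coords A T) = (quiver_of T', coords A T')"
  using assms
proof (induction rule: flip_path.induct)
  case (Cons k T T' ks T'')
  then show ?case
    by (simp add: flip_coords flip_quiver_of flip_colored_triangulation)
qed simp

section \<open>Lambda lengths with given cross-ratios\<close>

text \<open>Abstracts what subtraction-free operations preserve. Its instances are the positive
  reals inside the complex numbers and, pulled back along an evaluation,
  \<open>positive\<close>.\<close>

locale positive_cone =
  fixes P :: "'a::field \<Rightarrow> bool"
  assumes one: "P 1" and add: "P x \<Longrightarrow> P y \<Longrightarrow> P (x + y)" and mult: "P x \<Longrightarrow> P y \<Longrightarrow> P (x * y)"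
    and inverse: "P x \<Longrightarrow> P (inverse x)" and not_zero: "\<not> P 0"
begin

lemma divide: "P x \<Longrightarrow> P y \<Longrightarrow> P (x / y)"
  by (simp add: divide_inverse mult inverse)

lemma nonzero: "P x \<Longrightarrow> x \<noteq> 0"
  using not_zero by auto

lemma power: "P x \<Longrightarrow> P (x ^ n)"
  by (induction n) (simp_all add: one mult)

lemma power_int: "P x \<Longrightarrow> P (x powi m)"
  by (simp add: power_int_def power inverse)

lemma mutate_coords: "(\<And>\<alpha>. P (Z \<alpha>)) \<Longrightarrow> P (mutate_coords k \<epsilon> Z i)"
  by (simp add: mutate_coords_def mult inverse power_int add one)

text \<open>The second mutation sees both the sign of the arrow and \<open>Z k\<close> inverted, so
  the base \<open>1 + Z k powi (- sgn (\<epsilon> i k))\<close> is the same and its exponent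
  opposite. The factors cancel because the base is nonzero.\<close>

lemma mutate_coords_involution:
  assumes "\<And>\<alpha>. P (Z \<alpha>)"
  shows "mutate_coords k (mutate_quiver k \<epsilon>) (mutate_coords k \<epsilon> Z) = Z"
proof
  fix i
  have "1 + Z k powi (- sgn (\<epsilon> i k)) \<noteq> 0"
    using assms by (intro nonzero add one power_int)
  then show "mutate_coords k (mutate_quiver k \<epsilon>) (mutate_coords k \<epsilon> Z) i = Z i"
    by (simp add: mutate_coords_def mutate_quiver_def power_int_inverse power_int_minus)
qed

end

text \<open>The lambda lengths \<open>\<bar>det (v\<^sub>m, v\<^sub>n)\<bar>\<close> of a hexagon with vertices \<open>v\<^sub>0, \<dots>, v\<^sub>5\<close> in the
  plane that is normalized so that the triangle on the even vertices and every second edge have length 1.\<close>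

definition hexagon_length :: "'a::field \<Rightarrow> 'a \<Rightarrow> 'a \<Rightarrow> nat \<Rightarrow> nat \<Rightarrow> 'a" where
  "hexagon_length x y z m n =
     (let v = [1, 1, 0, - y, - 1, - 1 - z]; w = [0, x, 1, 1 + y, 1, 1];
          det = v ! m * w ! n - v ! n * w ! m
      in if m \<le> n then det else - det)"

lemma (in positive_cone) lambda_lengths_hexagon_length:
  assumes "P x" "P y" "P z"
  shows "lambda_lengths (hexagon_length x y z)"
proof
  fix m n :: nat
  show "hexagon_length x y z m n = hexagon_length x y z n m"
    by (auto simp: hexagon_length_def Let_def)
  show "hexagon_length x y z m n \<noteq> 0" if "m < 6" "n < 6" "m \<noteq> n"
  proof -
    have "P (hexagon_length x y z m n)" if "m < n" "n < 6" for m n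
    proof -
      have "m \<in> {0, 1, 2, 3, 4}" "n \<in> {1, 2, 3, 4, 5}"
        using that by auto
      \<comment> \<open>After expansion the negative terms cancel and each determinant is a sum of
        products of 1, \<open>x\<close>, \<open>y\<close>, \<open>z\<close>; vertices 3 and 5, for
        instance, give \<open>1 + z + y * z\<close>.\<close>
      then show ?thesis
        using that assms unfolding hexagon_length_def Let_def
        by (elim insertE emptyE; simp add: algebra_simps add mult one)
    qed
    then show ?thesis
      using that nonzero \<open>hexagon_length x y z m n = hexagon_length x y z n m\<close> by (metis nat_neq_iff)
  qed
next
  fix a b c d :: nat
  assume "ccw a b c" "ccw a c d"
  \<comment> \<open>The sign of the length depends on the order of the indices, so the cases single
    out the smallest of the four. In each of them the identity is the Pluecker relation for four
    vectors in the plane.\<close>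
  then consider "a < b" "b < c" "c < d" | "b < c" "c < d" "d < a" | "c < d" "d < a" "a < b" | "d < a" "a < b" "b < c"
    unfolding ccw_def by linarith
  then show "hexagon_length x y z a c * hexagon_length x y z b d =
      hexagon_length x y z a b * hexagon_length x y z c d + hexagon_length x y z b c * hexagon_length x y z d a"
    by cases (simp_all add: hexagon_length_def Let_def algebra_simps)
qed

section \<open>Flips towards the triangle on the even vertices\<close>

lemma UNIV_color: "UNIV = {Orange, Blue, Green}"
  by (auto intro: color.exhaust)

lemma quad_exists:
  assumes "colored_triangulation T"
  obtains a b c d where "quad T k a b c d"
  using flip_local_exists[OF assms] unfolding flip_local_def by blast

text \<open>Termination measure: among colored triangulations it vanishes only on those of the even
  triangle, where explicit lengths are available.\<close>

definition odd_ends :: "triangulation \<Rightarrow> nat" where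
  "odd_ends T = (\<Sum>\<alpha>\<in>{Orange, Blue, Green}. card {v \<in> T \<alpha>. odd v})"

lemma odd_ends_fun_upd:
  assumes "card {v \<in> y. odd v} < card {v \<in> T k. odd v}"
  shows "odd_ends (T(k := y)) < odd_ends T"
  unfolding odd_ends_def
proof (rule sum_strict_mono_ex1)
  show "\<exists>x\<in>{Orange, Blue, Green}. card {v \<in> (T(k := y)) x. odd v} < card {v \<in> T x. odd v}"
    using assms by (intro bexI[of _ k]) (simp, cases k, simp_all)
qed (use assms in auto)

lemma odd_less_6: "odd v \<Longrightarrow> v < 6 \<Longrightarrow> v \<in> {1, 3, 5 :: nat}"
  by (auto elim!: less_6_cases)

text \<open>Flipping a chord with two odd ends cuts off the even vertex between them.  In the absence of such
  chords, a chord with one odd end flips to a chord with none.\<close>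

lemma flip_odd_ends:
  assumes T: "colored_triangulation T" and v: "v \<in> T \<alpha>" "odd v"
  obtains k T' where "flip k T T'" "odd_ends T' < odd_ends T"
proof (cases "\<exists>k. \<forall>v\<in>T k. odd v")
  case True
  then obtain k where k: "\<forall>v\<in>T k. odd v"
    by blast
  obtain a b c d where q: "quad T k a b c d"
    using quad_exists[OF T] .
  have "odd a" "odd c" "T k = {a, c}"
    using q k by (auto simp: quad_def)
  moreover note quad_vertices[OF T q] quad_distinct[OF q]
  \<comment> \<open>There are only three odd vertices, and \<open>a\<close> and \<open>c\<close> use
    two of them.\<close>
  ultimately have "even b \<or> even d"
    using odd_less_6[of a] odd_less_6[of b] odd_less_6[of c] odd_less_6[of d] by auto
  then have "{v \<in> {b, d}. odd v} \<subseteq> {b} \<or> {v \<in> {b, d}. odd v} \<subseteq> {d}"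
    by blast
  then have "card {v \<in> {b, d}. odd v} \<le> 1"
    using card_mono[of "{b}"] card_mono[of "{d}"] by fastforce
  moreover have "{v \<in> T k. odd v} = {a, c}"
    using \<open>T k = {a, c}\<close> \<open>odd a\<close> \<open>odd c\<close> by auto
  then have "card {v \<in> T k. odd v} = 2"
    using quad_distinct[OF q] by simp
  ultimately have "odd_ends (T(k := {b, d})) < odd_ends T"
    by (intro odd_ends_fun_upd) simp
  then show ?thesis
    using that q flip_iff_quad by blast
next
  case False
  \<comment> \<open>An edge of the hexagon joins vertices of different parity, and chords with two
    odd ends are excluded in this case. Hence both neighbours of an odd end of the flipped chord are
    even.\<close>
  have odd_side: False if "{x, y} \<in> sides T" "odd x" "odd y" for x y
  proof -
    have "{x, y} \<notin> range T"
      using False that by force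
    then have "{x, y} \<in> hexagon_edges"
      using that by (simp add: sides_def)
    then show False
      using that by (auto simp: hexagon_edges_eq doubleton_eq_iff)
  qed
  obtain a b c d where q: "quad T \<alpha> a b c d"
    using quad_exists[OF T] .
  have "odd a \<or> odd c"
    using q v by (auto simp: quad_def)
  then have "even b" "even d"
    using q odd_side[of a b] odd_side[of b c] odd_side[of c d] odd_side[of d a]
    by (auto simp: quad_def)
  then have no_odd: "{w \<in> {b, d}. odd w} = {}"
    by auto
  have "finite {w \<in> T \<alpha>. odd w}" "{w \<in> T \<alpha>. odd w} \<noteq> {}"
    using q v by (auto simp: quad_def)
  then have "odd_ends (T(\<alpha> := {b, d})) < odd_ends T"
    by (intro odd_ends_fun_upd) (simp only: no_odd card.empty card_gt_0_iff simp_thms)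
  then show ?thesis
    using that q flip_iff_quad by blast
qed

definition triangle :: "nat \<Rightarrow> triangulation \<Rightarrow> color \<Rightarrow> color \<Rightarrow> color \<Rightarrow> bool" where
  "triangle a T i j k \<longleftrightarrow> UNIV = {i, j, k} \<and> distinct [i, j, k] \<and>
     T i = {rot a 0, rot a 2} \<and> T j = {rot a 2, rot a 4} \<and> T k = {rot a 4, rot a 0}"

lemma triangle_quad:
  assumes "triangle a T i j k"
  shows "quad T i (rot a 0) (rot a 1) (rot a 2) (rot a 4)"
    and "quad T j (rot a 2) (rot a 3) (rot a 4) (rot a 0)"
    and "quad T k (rot a 4) (rot a 5) (rot a 0) (rot a 2)"
  using assms unfolding triangle_def
  by (simp_all add: quad_def triangulation_sides[of i j k T] hexagon_edges_rot[of a] doubleton_eq_iff)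

lemma triangle_of_range:
  assumes T: "colored_triangulation T"
    and range: "range T = {{rot a 0, rot a 2}, {rot a 2, rot a 4}, {rot a 4, rot a 0}}"
  obtains i j k where "triangle a T i j k"
proof -
  have "{rot a 0, rot a 2} \<in> range T" "{rot a 2, rot a 4} \<in> range T" "{rot a 4, rot a 0} \<in> range T"
    unfolding range by simp_all
  then obtain i j k where ijk: "T i = {rot a 0, rot a 2}" "T j = {rot a 2, rot a 4}" "T k = {rot a 4, rot a 0}"
    by (elim rangeE) metis
  then have "T i \<noteq> T j" "T i \<noteq> T k" "T j \<noteq> T k"
    by (simp_all add: doubleton_eq_iff)
  then have "distinct [i, j, k]"
    by auto
  moreover have "x \<in> {i, j, k}" for x
  proof -
    have "T x \<in> range T"
      by simp
    then have "T x = T i \<or> T x = T j \<or> T x = T k"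
      unfolding range ijk by simp
    then show ?thesis
      using T by (auto simp: colored_triangulation_def inj_eq)
  qed
  then have "UNIV = {i, j, k}"
    by blast
  ultimately show ?thesis
    using that[of i j k] ijk by (simp add: triangle_def)
qed

lemma even_triangle:
  assumes T: "colored_triangulation T" and even: "\<And>\<alpha> v. v \<in> T \<alpha> \<Longrightarrow> even v"
  obtains i j k where "triangle 0 T i j k"
proof -
  have "T \<alpha> \<in> {{0, 2}, {2, 4}, {4, 0}}" for \<alpha>
  proof -
    have "T \<alpha> \<in> diagonals"
      using T by (auto simp: colored_triangulation_def)
    moreover have "\<forall>v\<in>T \<alpha>. even v"
      using even by blast
    ultimately show ?thesis
      unfolding diagonals_eq by (elim insertE emptyE; simp)
  qed
  then have "range T \<subseteq> {{0, 2}, {2, 4}, {4, 0}}"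
    by (rule image_subsetI)
  moreover have "card (range T) = 3"
    using T card_image[of T UNIV] by (simp add: colored_triangulation_def UNIV_color)
  ultimately have "range T = {{0, 2}, {2, 4}, {4, 0}}"
    by (intro card_subset_eq) (simp_all add: card_insert_if doubleton_eq_iff)
  moreover have "rot 0 0 = 0" "rot 0 2 = 2" "rot 0 4 = 4"
    by (simp_all add: rot_def)
  ultimately have "range T = {{rot 0 0, rot 0 2}, {rot 0 2, rot 0 4}, {rot 0 4, rot 0 0}}"
    by simp
  then show ?thesis
    using triangle_of_range[OF T] that by blast
qed

lemma (in positive_cone) lambda_lengths_exist:
  assumes "colored_triangulation T" "\<And>\<alpha>. P (Z \<alpha>)"
  shows "\<exists>A. lambda_lengths A \<and> coords A T = Z"
  using assms
proof (induction "odd_ends T" arbitrary: T Z rule: less_induct)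
  case less
  show ?case
  proof (cases "\<exists>\<alpha> v. v \<in> T \<alpha> \<and> odd v")
    case True
    then obtain k T' where flip: "flip k T T'" and less': "odd_ends T' < odd_ends T"
      using flip_odd_ends[OF less.prems(1)] by blast
    have T': "colored_triangulation T'"
      using flip_colored_triangulation[OF less.prems(1) flip] .
    let ?Z = "mutate_coords k (quiver_of T) Z"
    obtain A where "lambda_lengths A" and A: "coords A T' = ?Z"
      using less.hyps[OF less' T', of ?Z] less.prems(2) mutate_coords by blast
    then interpret lambda_lengths A
      by simp
    have "coords A T = mutate_coords k (quiver_of T') (coords A T')"
      using flip_coords[OF T' flip_commute[OF flip]] .
    also have "\<dots> = Z"
      unfolding A flip_quiver_of[OF less.prems(1) flip] using less.prems(2) by (rule mutate_coords_involution)
    finally show ?thesis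
      using \<open>lambda_lengths A\<close> by blast
  next
    case False
    then obtain i j k where tri: "triangle 0 T i j k"
      using even_triangle[OF less.prems(1)] by blast
    \<comment> \<open>In this normal form each cross-ratio of the even triangle has a single factor
      other than 1: the edge 01, 23 or 45, of length \<open>Z i\<close>, \<open>Z j\<close> or
      \<open>Z k\<close>.\<close>
    define A where "A = hexagon_length (Z i) (Z j) (Z k)"
    have "coords A T i = Z i" "coords A T j = Z j" "coords A T k = Z k"
      unfolding triangle_quad[OF tri, THEN coords_quad[OF less.prems(1), of _ _ _ _ _ A]]
      by (simp_all add: A_def hexagon_length_def Let_def rot_def)
    moreover have "x \<in> {i, j, k}" for x
      using tri unfolding triangle_def by blast
    ultimately have "coords A T = Z"
      by fastforce
    moreover have "lambda_lengths A"
      unfolding A_def using less.prems(2) by (intro lambda_lengths_hexagon_length)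
    ultimately show ?thesis
      by blast
  qed
qed

section \<open>The rotation by pi of an equilateral triangulation\<close>

lemma lambda_lengths_rot:
  assumes "lambda_lengths A"
  shows "lambda_lengths (\<lambda>u v. A (rot n u) (rot n v))"
proof
  interpret lambda_lengths A
    by fact
  fix a b c d
  show "A (rot n a) (rot n b) = A (rot n b) (rot n a)"
    by (rule commute)
  show "A (rot n a) (rot n b) \<noteq> 0" if "a < 6" "b < 6" "a \<noteq> b"
    using that by (intro nonzero) simp_all
  show "A (rot n a) (rot n c) * A (rot n b) (rot n d) =
      A (rot n a) (rot n b) * A (rot n c) (rot n d) + A (rot n b) (rot n c) * A (rot n d) (rot n a)"
    if "{a, b, c, d} \<subseteq> {..<6}" "ccw a b c" "ccw a c d"
    using that ccw_rot[of a b c n] ccw_rot[of a c d n]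
    by (intro ptolemy) (simp_all add: ccw_def[of a b c] ccw_def[of a c d])
qed

text \<open>An inverse rotation within the natural numbers, used to transport lengths from the
  standard position to a triangle at any offset. Reducing \<open>a\<close> first prevents truncated
  subtraction.\<close>

lemma rot_rot: "m < 6 \<Longrightarrow> rot (6 - a mod 6) (rot a m) = m"
proof -
  assume "m < 6"
  have "rot a m = (a mod 6 + m) mod 6"
    by (simp add: rot_def mod_add_left_eq)
  then have "rot (6 - a mod 6) (rot a m) = (6 - a mod 6 + (a mod 6 + m)) mod 6"
    by (simp only: rot_def mod_add_right_eq)
  also have "6 - a mod 6 + (a mod 6 + m) = 6 + m"
    using mod_less_divisor[of 6 a] by linarith
  finally show ?thesis
    using \<open>m < 6\<close> by simp
qed

text \<open>Here \<open>x\<close>, \<open>y\<close>, \<open>z\<close> are the coordinates of the chords of an equilateral triangle in counterclockwise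
  order, and the result is the coordinate of the first chord after the rotation.\<close>

definition rotation_formula :: "'a::field \<Rightarrow> 'a \<Rightarrow> 'a \<Rightarrow> 'a" where
  "rotation_formula x y z = (1 + x + x * z) / (z * (1 + y + x * y))"

lemma rotate_pi_rot: "(\<lambda>v. (v + 3) mod 6) ` {rot a m, rot a n} = {rot a (m + 3), rot a (n + 3)}"
  by (simp add: rot_def mod_add_left_eq add.assoc)

lemma rot_add_6: "6 \<le> m \<Longrightarrow> rot a m = rot a (m - 6)"
  by (simp add: rot_def mod_if)

lemma triangle_rotate_pi:
  assumes "triangle a T i j k"
  shows "rotate_pi T i = {rot a 3, rot a 5}" "rotate_pi T j = {rot a 5, rot a 1}"
    "rotate_pi T k = {rot a 1, rot a 3}"
  using assms unfolding triangle_def rotate_pi_def by (simp_all add: rotate_pi_rot rot_add_6 del: image_insert)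

lemma triangle_rotate_pi_quad:
  assumes "triangle a T i j k"
  shows "quad (rotate_pi T) i (rot a 3) (rot a 4) (rot a 5) (rot a 1)"
    and "quad (rotate_pi T) j (rot a 5) (rot a 0) (rot a 1) (rot a 3)"
    and "quad (rotate_pi T) k (rot a 1) (rot a 2) (rot a 3) (rot a 5)"
  using assms unfolding triangle_def
  by (simp_all add: quad_def triangulation_sides[of i j k "rotate_pi T"] hexagon_edges_rot[of a] doubleton_eq_iff
      triangle_rotate_pi[OF assms])

lemma triangle_rotate_pi_colored:
  assumes "triangle a T i j k"
  shows "colored_triangulation (rotate_pi T)"
  using assms unfolding triangle_def
  by (intro colored_triangulationI[of i j k])
    (simp_all add: diagonals_rot[of a] crossing_doubleton doubleton_eq_iff triangle_rotate_pi[OF assms])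

text \<open>With \<open>x\<close>, \<open>y\<close>, \<open>z\<close> for the three coordinates and
  vertices counted from \<open>a\<close>, the edges 01, 23, 45 have lengths \<open>x\<close>,
  \<open>y\<close>, \<open>z\<close> and the other edges length 1. The sides 51, 13, 35 of the odd
  triangle have lengths \<open>1 + x + x * z\<close>, \<open>1 + y + x * y\<close>,
  \<open>1 + z + y * z\<close>: these are the trinomials of the formula.\<close>

lemma (in positive_cone) triangle_rotate_pi_coords:
  assumes "colored_triangulation T" "triangle a T i j k" "\<And>\<alpha>. P (Z \<alpha>)" "flip_path T p (rotate_pi T)"
  shows "snd (fold mutate p (quiver_of T, Z)) i = rotation_formula (Z i) (Z j) (Z k)"
    and "snd (fold mutate p (quiver_of T, Z)) j = rotation_formula (Z j) (Z k) (Z i)"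
    and "snd (fold mutate p (quiver_of T, Z)) k = rotation_formula (Z k) (Z i) (Z j)"
proof -
  define B where "B = hexagon_length (Z i) (Z j) (Z k)"
  define A where "A = (\<lambda>u v. B (rot (6 - a mod 6) u) (rot (6 - a mod 6) v))"
  have A_rot: "A (rot a m) (rot a n) = B m n" if "m < 6" "n < 6" for m n
    using that by (simp add: A_def rot_rot)
  interpret lambda_lengths A
    unfolding A_def B_def using assms(3) by (intro lambda_lengths_rot lambda_lengths_hexagon_length)
  have "coords A T i = Z i" "coords A T j = Z j" "coords A T k = Z k"
    unfolding triangle_quad[OF assms(2), THEN coords_quad[OF assms(1), of _ _ _ _ _ A]]
    by (simp_all add: A_rot) (simp_all add: B_def hexagon_length_def Let_def)
  moreover have "x \<in> {i, j, k}" for x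
    using assms(2) unfolding triangle_def by blast
  ultimately have "coords A T = Z"
    by fastforce
  then have *: "snd (fold mutate p (quiver_of T, Z)) = coords A (rotate_pi T)"
    using flip_path_coords[OF assms(4,1)] by simp
  note triangle_rotate_pi_colored[OF assms(2)]
  note quads = triangle_rotate_pi_quad[OF assms(2), THEN coords_quad[OF this, of _ _ _ _ _ A]]
  show "snd (fold mutate p (quiver_of T, Z)) i = rotation_formula (Z i) (Z j) (Z k)"
    and "snd (fold mutate p (quiver_of T, Z)) j = rotation_formula (Z j) (Z k) (Z i)"
    and "snd (fold mutate p (quiver_of T, Z)) k = rotation_formula (Z k) (Z i) (Z j)"
    unfolding * quads
    by (simp_all add: A_rot) (simp_all add: B_def hexagon_length_def Let_def rotation_formula_def algebra_simps)
qed

lemma flipI: "quad T k a b c d \<Longrightarrow> T' = T(k := {b, d}) \<Longrightarrow> flip k T T'"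
  unfolding flip_iff_quad by blast

text \<open>The last four flips carry the even triangle to the odd one, but on their own they would
  leave the colors \<open>i\<close> and \<open>j\<close> interchanged compared with the rotation.
  The first five correct this in advance: five alternating flips inside the pentagon bounded by the
  chord \<open>k\<close> return to the same chords with the two colors swapped.\<close>

lemma flip_path_rotate_pi:
  assumes "triangle a T i j k"
  shows "flip_path T [i, j, i, j, i, k, i, j, k] (rotate_pi T)"
proof -
  let ?r = "rot a"
  let ?C = "\<lambda>x y z. T(i := x, j := y, k := z)"
  have ijk: "UNIV = {i, j, k}" "i \<noteq> j" "j \<noteq> k" "i \<noteq> k" "j \<noteq> i" "k \<noteq> j" "k \<noteq> i"
    and T: "T i = {?r 0, ?r 2}" "T j = {?r 2, ?r 4}" "T k = {?r 4, ?r 0}"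
    using assms by (auto simp: triangle_def)
  note rules = ijk(2-) quad_def triangulation_sides[OF ijk(1)] hexagon_edges_rot[of a] doubleton_eq_iff
    fun_upd_twist
  have 1: "flip i (?C {?r 0, ?r 2} {?r 2, ?r 4} {?r 4, ?r 0}) (?C {?r 1, ?r 4} {?r 2, ?r 4} {?r 4, ?r 0})"
    by (rule flipI[of _ _ "?r 0" "?r 1" "?r 2" "?r 4"]) (simp_all add: rules)
  have 2: "flip j (?C {?r 1, ?r 4} {?r 2, ?r 4} {?r 4, ?r 0}) (?C {?r 1, ?r 4} {?r 3, ?r 1} {?r 4, ?r 0})"
    by (rule flipI[of _ _ "?r 2" "?r 3" "?r 4" "?r 1"]) (simp_all add: rules)
  have 3: "flip i (?C {?r 1, ?r 4} {?r 3, ?r 1} {?r 4, ?r 0}) (?C {?r 3, ?r 0} {?r 3, ?r 1} {?r 4, ?r 0})"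
    by (rule flipI[of _ _ "?r 1" "?r 3" "?r 4" "?r 0"]) (simp_all add: rules)
  have 4: "flip j (?C {?r 3, ?r 0} {?r 3, ?r 1} {?r 4, ?r 0}) (?C {?r 3, ?r 0} {?r 2, ?r 0} {?r 4, ?r 0})"
    by (rule flipI[of _ _ "?r 1" "?r 2" "?r 3" "?r 0"]) (simp_all add: rules)
  have 5: "flip i (?C {?r 3, ?r 0} {?r 2, ?r 0} {?r 4, ?r 0}) (?C {?r 2, ?r 4} {?r 2, ?r 0} {?r 4, ?r 0})"
    by (rule flipI[of _ _ "?r 0" "?r 2" "?r 3" "?r 4"]) (simp_all add: rules)
  have 6: "flip k (?C {?r 2, ?r 4} {?r 2, ?r 0} {?r 4, ?r 0}) (?C {?r 2, ?r 4} {?r 2, ?r 0} {?r 2, ?r 5})"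
    by (rule flipI[of _ _ "?r 0" "?r 2" "?r 4" "?r 5"]) (simp_all add: rules)
  have 7: "flip i (?C {?r 2, ?r 4} {?r 2, ?r 0} {?r 2, ?r 5}) (?C {?r 3, ?r 5} {?r 2, ?r 0} {?r 2, ?r 5})"
    by (rule flipI[of _ _ "?r 2" "?r 3" "?r 4" "?r 5"]) (simp_all add: rules)
  have 8: "flip j (?C {?r 3, ?r 5} {?r 2, ?r 0} {?r 2, ?r 5}) (?C {?r 3, ?r 5} {?r 1, ?r 5} {?r 2, ?r 5})"
    by (rule flipI[of _ _ "?r 0" "?r 1" "?r 2" "?r 5"]) (simp_all add: rules)
  have 9: "flip k (?C {?r 3, ?r 5} {?r 1, ?r 5} {?r 2, ?r 5}) (?C {?r 3, ?r 5} {?r 1, ?r 5} {?r 3, ?r 1})"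
    by (rule flipI[of _ _ "?r 2" "?r 3" "?r 5" "?r 1"]) (simp_all add: rules)
  have "?C {?r 0, ?r 2} {?r 2, ?r 4} {?r 4, ?r 0} = T"
    using T by (auto simp: fun_eq_iff)
  moreover have "x = i \<or> x = j \<or> x = k" for x
    using ijk(1) by blast
  then have "?C {?r 3, ?r 5} {?r 1, ?r 5} {?r 3, ?r 1} = rotate_pi T"
    using ijk(2-) by (intro ext) (auto simp: triangle_rotate_pi[OF assms] insert_commute)
  ultimately show ?thesis
    using flip_path.Cons[OF 1 flip_path.Cons[OF 2 flip_path.Cons[OF 3 flip_path.Cons[OF 4
        flip_path.Cons[OF 5 flip_path.Cons[OF 6 flip_path.Cons[OF 7 flip_path.Cons[OF 8
        flip_path.Cons[OF 9 flip_path.Nil]]]]]]]]]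
    by simp
qed

section \<open>Substitutions\<close>

definition is_hom :: "('a::comm_ring_1 \<Rightarrow> 'b::comm_ring_1) \<Rightarrow> bool" where
  "is_hom f \<longleftrightarrow> (\<forall>x y. f (x + y) = f x + f y) \<and> (\<forall>x y. f (x * y) = f x * f y) \<and> f 1 = 1"

lemma is_homD:
  assumes "is_hom f"
  shows "f (x + y) = f x + f y" "f (x * y) = f x * f y" "f 1 = 1" "f 0 = 0"
proof -
  show "f (x + y) = f x + f y" "f (x * y) = f x * f y" "f 1 = 1"
    using assms by (auto simp: is_hom_def)
  have "f (0 + 0) = f 0 + f 0"
    using assms unfolding is_hom_def by blast
  then show "f 0 = 0"
    by simp
qed

text \<open>The universal property of the polynomial ring; \<open>eval_poly3\<close> iterates it
  through the three nested rings.\<close>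

definition poly_ext :: "('a::comm_ring_1 \<Rightarrow> 'b::comm_ring_1) \<Rightarrow> 'b \<Rightarrow> 'a poly \<Rightarrow> 'b" where
  "poly_ext f x p = poly (map_poly f p) x"

lemma poly_ext_pCons: "is_hom f \<Longrightarrow> poly_ext f x (pCons a p) = f a + x * poly_ext f x p"
  by (simp add: poly_ext_def map_poly_pCons is_homD)

lemma poly_ext_0: "poly_ext f x 0 = 0"
  by (simp add: poly_ext_def)

lemma is_hom_poly_ext:
  assumes "is_hom f"
  shows "is_hom (poly_ext f x)"
proof -
  note simps = poly_ext_pCons[OF assms] poly_ext_0 is_homD[OF assms]
  have add: "poly_ext f x (p + q) = poly_ext f x p + poly_ext f x q" for p q
    by (induction p q rule: poly_induct2) (simp_all add: simps algebra_simps)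
  have smult: "poly_ext f x (smult a q) = f a * poly_ext f x q" for a q
    by (induction q) (simp_all add: simps algebra_simps)
  have "poly_ext f x (p * q) = poly_ext f x p * poly_ext f x q" for p q
    by (induction p) (simp_all add: simps add smult algebra_simps)
  then show ?thesis
    using add by (simp add: is_hom_def one_pCons simps)
qed

lemma poly_closure_induct [case_names const var add mult]:
  fixes p :: "'a::comm_ring_1 poly"
  assumes "\<And>c. P [:c:]" "P [:0, 1:]" "\<And>p q. P p \<Longrightarrow> P q \<Longrightarrow> P (p + q)" "\<And>p q. P p \<Longrightarrow> P q \<Longrightarrow> P (p * q)"
  shows "P p"
proof (induction p)
  case 0
  then show ?case
    using assms(1)[of 0] by simp
next
  case (pCons a p)
  have "pCons a p = [:a:] + [:0, 1:] * p"
    by simp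
  then show ?case
    using assms pCons.IH by metis
qed

text \<open>A relation, since the extension of \<open>f\<close> to fractions is partial when \<open>f\<close> has a kernel.\<close>

definition fract_ext :: "('a::idom \<Rightarrow> 'b::field) \<Rightarrow> 'a fract \<Rightarrow> 'b \<Rightarrow> bool" where
  "fract_ext f r v \<longleftrightarrow> (\<exists>a b. r = Fract a b \<and> f b \<noteq> 0 \<and> v = f a / f b)"

context
  fixes f :: "'a::idom \<Rightarrow> 'b::field"
  assumes f: "is_hom f"
begin

lemma fract_ext_unique:
  assumes "fract_ext f r v" "fract_ext f r w"
  shows "v = w"
proof -
  obtain a b c d where *: "r = Fract a b" "f b \<noteq> 0" "v = f a / f b" "r = Fract c d" "f d \<noteq> 0" "w = f c / f d"
    using assms unfolding fract_ext_def by blast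
  then have "b \<noteq> 0" "d \<noteq> 0"
    using is_homD(4)[OF f] by auto
  then have "a * d = c * b"
    using * by (simp add: eq_fract)
  then have "f a * f d = f c * f b"
    by (metis is_homD(2)[OF f])
  then show ?thesis
    unfolding *(3,6) using *(2,5) by (simp add: frac_eq_eq)
qed

lemma fract_ext_to_fract: "fract_ext f (to_fract p) (f p)"
  unfolding fract_ext_def to_fract_def using is_homD[OF f]
  by (metis div_by_1 zero_neq_one)

lemma fract_ext_add:
  assumes "fract_ext f r v" "fract_ext f s w"
  shows "fract_ext f (r + s) (v + w)"
proof -
  obtain a b c d where *: "r = Fract a b" "f b \<noteq> 0" "v = f a / f b" "s = Fract c d" "f d \<noteq> 0" "w = f c / f d"
    using assms unfolding fract_ext_def by blast
  then have "b \<noteq> 0" "d \<noteq> 0"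
    using is_homD(4)[OF f] by auto
  then show ?thesis
    unfolding fract_ext_def using *
    by (intro exI[of _ "a * d + c * b"] exI[of _ "b * d"] conjI) (simp_all add: is_homD(1,2)[OF f] add_frac_eq)
qed

lemma fract_ext_mult:
  assumes "fract_ext f r v" "fract_ext f s w"
  shows "fract_ext f (r * s) (v * w)"
proof -
  obtain a b c d where *: "r = Fract a b" "f b \<noteq> 0" "v = f a / f b" "s = Fract c d" "f d \<noteq> 0" "w = f c / f d"
    using assms unfolding fract_ext_def by blast
  then show ?thesis
    unfolding fract_ext_def
    by (intro exI[of _ "a * c"] exI[of _ "b * d"] conjI) (simp_all add: is_homD(2)[OF f])
qed

lemma fract_ext_inverse:
  assumes "fract_ext f r v" "v \<noteq> 0"
  shows "fract_ext f (inverse r) (inverse v)"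
proof -
  obtain a b where *: "r = Fract a b" "f b \<noteq> 0" "v = f a / f b"
    using assms unfolding fract_ext_def by blast
  then show ?thesis
    unfolding fract_ext_def using assms(2)
    by (intro exI[of _ b] exI[of _ a]) simp
qed

lemma fract_ext_divide: "fract_ext f r v \<Longrightarrow> fract_ext f s w \<Longrightarrow> w \<noteq> 0 \<Longrightarrow> fract_ext f (r / s) (v / w)"
  by (simp add: divide_inverse fract_ext_mult fract_ext_inverse)

lemma fract_ext_0: "fract_ext f 0 0" and fract_ext_1: "fract_ext f 1 1"
  using fract_ext_to_fract[of 0] fract_ext_to_fract[of 1] by (simp_all add: is_homD[OF f])

text \<open>Fractions with a denominator outside the kernel of \<open>f\<close> form a local ring on
  which the extension is a homomorphism. Values in the cone are nonzero, so inverses stay in that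
  ring.\<close>

lemma positive_cone_fract_ext:
  assumes "positive_cone Q"
  shows "positive_cone (\<lambda>r. \<exists>v. Q v \<and> fract_ext f r v)"
proof -
  interpret positive_cone Q
    by fact
  show ?thesis
  proof
    show "\<exists>v. Q v \<and> fract_ext f 1 v"
      using one fract_ext_1 by blast
    show "\<not> (\<exists>v. Q v \<and> fract_ext f 0 v)"
      using not_zero fract_ext_0 fract_ext_unique by blast
  next
    fix x y
    assume "\<exists>v. Q v \<and> fract_ext f x v" "\<exists>v. Q v \<and> fract_ext f y v"
    then obtain v w where vw: "Q v" "fract_ext f x v" "Q w" "fract_ext f y w"
      by blast
    show "\<exists>v. Q v \<and> fract_ext f (x + y) v"
      using add[OF vw(1,3)] fract_ext_add[OF vw(2,4)] by blast
    show "\<exists>v. Q v \<and> fract_ext f (x * y) v"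
      using mult[OF vw(1,3)] fract_ext_mult[OF vw(2,4)] by blast
  next
    fix x
    assume "\<exists>v. Q v \<and> fract_ext f x v"
    then show "\<exists>v. Q v \<and> fract_ext f (inverse x) v"
      using inverse nonzero fract_ext_inverse by blast
  qed
qed

lemma inj_fract_ext_hom:
  assumes inj: "\<And>p. f p = 0 \<Longrightarrow> p = 0"
  obtains g where "is_hom g" "\<And>p. g (to_fract p) = f p"
proof -
  have ex: "\<exists>v. fract_ext f r v" for r
  proof (cases r)
    case (Fract a b)
    then show ?thesis
      using inj unfolding fract_ext_def by blast
  qed
  define g where "g r = (THE v. fract_ext f r v)" for r
  have ext: "fract_ext f r (g r)" for r
    unfolding g_def using ex fract_ext_unique by (metis theI)
  have "g (x + y) = g x + g y" "g (x * y) = g x * g y" "g 1 = 1" for x y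
    by (rule fract_ext_unique[OF ext], intro fract_ext_add fract_ext_mult fract_ext_1 ext)+
  then have "is_hom g"
    by (simp add: is_hom_def)
  moreover have "g (to_fract p) = f p" for p
    using ext fract_ext_unique fract_ext_to_fract by blast
  ultimately show ?thesis
    using that by blast
qed

end

section \<open>Polynomials and rational functions in three variables\<close>

definition eval_poly3 :: "(complex \<Rightarrow> 'a::comm_ring_1) \<Rightarrow> (color \<Rightarrow> 'a) \<Rightarrow> complex poly poly poly \<Rightarrow> 'a" where
  "eval_poly3 f F = poly_ext (poly_ext (poly_ext f (F Orange)) (F Blue)) (F Green)"

lemma is_hom_eval_poly3: "is_hom f \<Longrightarrow> is_hom (eval_poly3 f F)"
  by (simp add: eval_poly3_def is_hom_poly_ext)

lemma eval_poly3_const: "is_hom f \<Longrightarrow> eval_poly3 f F [:[:[:c:]:]:] = f c"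
  by (simp add: eval_poly3_def poly_ext_pCons poly_ext_0 is_hom_poly_ext)

fun Var_poly :: "color \<Rightarrow> complex poly poly poly" where
  "Var_poly Orange = [:[:[:0, 1:]:]:]"
| "Var_poly Blue = [:[:0, 1:]:]"
| "Var_poly Green = [:0, 1:]"

lemma Var_eq: "Var \<alpha> = to_fract (Var_poly \<alpha>)"
  by (cases \<alpha>) simp_all

lemma eval_poly3_Var: "is_hom f \<Longrightarrow> eval_poly3 f F (Var_poly \<alpha>) = F \<alpha>"
  by (cases \<alpha>) (simp_all add: eval_poly3_def poly_ext_pCons poly_ext_0 is_hom_poly_ext is_homD)

lemma poly3_closure_induct [case_names const var add mult]:
  fixes p :: "complex poly poly poly"
  assumes const: "\<And>c. P [:[:[:c:]:]:]" and var: "\<And>\<alpha>. P (Var_poly \<alpha>)"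
    and add: "\<And>p q. P p \<Longrightarrow> P q \<Longrightarrow> P (p + q)" and mult: "\<And>p q. P p \<Longrightarrow> P q \<Longrightarrow> P (p * q)"
  shows "P p"
proof (induction p rule: poly_closure_induct)
  case (const p)
  show ?case
  proof (induction p rule: poly_closure_induct)
    case (const p)
    show ?case
    proof (induction p rule: poly_closure_induct)
      case (const c)
      show ?case
        by (fact assms(1))
    next
      case var
      show ?case
        using assms(2)[of Orange] by simp
    next
      case (add p q)
      then show ?case
        using assms(3)[of "[:[:p:]:]" "[:[:q:]:]"] by simp
    next
      case (mult p q)
      then show ?case
        using assms(4)[of "[:[:p:]:]" "[:[:q:]:]"] by simp
    qed
  next
    case var
    show ?case
      using assms(2)[of Blue] by simp
  next
    case (add p q)
    then show ?case
      using assms(3)[of "[:p:]" "[:q:]"] by simp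
  next
    case (mult p q)
    then show ?case
      using assms(4)[of "[:p:]" "[:q:]"] by (simp add: mult.commute)
  qed
next
  case var
  show ?case
    using assms(2)[of Green] by simp
qed (use add mult in auto)

text \<open>Positivity at a single point already keeps all the denominators nonzero.\<close>

definition positive :: "ratfun \<Rightarrow> bool" where
  "positive r \<longleftrightarrow> (\<exists>v. (\<exists>x>0. v = complex_of_real x) \<and> fract_ext (eval_poly3 (\<lambda>c. c) (\<lambda>_. 1)) r v)"

lemma is_hom_ident: "is_hom (\<lambda>c. c)"
  by (simp add: is_hom_def)

lemma positive_cone_complex: "positive_cone (\<lambda>v. \<exists>x>0. v = complex_of_real x)"
proof
  show "\<exists>x>0. 1 = complex_of_real x"
    by (intro exI[of _ 1]) simp
  show "\<not> (\<exists>x>0. 0 = complex_of_real x)"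
    by simp
next
  fix v w
  assume "\<exists>x>0. v = complex_of_real x" "\<exists>x>0. w = complex_of_real x"
  then obtain x y where "0 < x" "v = complex_of_real x" "0 < y" "w = complex_of_real y"
    by blast
  then show "\<exists>x>0. v + w = complex_of_real x" "\<exists>x>0. v * w = complex_of_real x"
    by (intro exI[of _ "x + y"], simp, intro exI[of _ "x * y"], simp)
next
  fix v
  assume "\<exists>x>0. v = complex_of_real x"
  then obtain x where "0 < x" "v = complex_of_real x"
    by blast
  then show "\<exists>x>0. inverse v = complex_of_real x"
    by (intro exI[of _ "inverse x"]) simp
qed

interpretation positive: positive_cone positive
  unfolding positive_def
  by (intro positive_cone_fract_ext is_hom_eval_poly3 is_hom_ident positive_cone_complex)

lemma positive_Var: "positive (Var \<alpha>)"
proof -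
  let ?e = "eval_poly3 (\<lambda>c. c) (\<lambda>_. 1)"
  have "fract_ext ?e (Var \<alpha>) (?e (Var_poly \<alpha>))"
    unfolding Var_eq by (intro fract_ext_to_fract is_hom_eval_poly3 is_hom_ident)
  then show ?thesis
    unfolding positive_def eval_poly3_Var[OF is_hom_ident] by (intro exI[of _ 1]) (auto intro: exI[of _ 1])
qed

lemma is_hom_Const: "is_hom Const"
  by (simp add: is_hom_def Const_def pCons_one flip: to_fract_add to_fract_mult)

text \<open>The unit law is hidden in the condition on constants, since \<open>Const 1\<close> is
  1.\<close>

lemma is_substitution_hom:
  assumes "is_substitution F \<sigma>"
  shows "is_hom \<sigma>"
proof -
  have "\<sigma> (Const 1) = Const 1"
    using assms by (auto simp: is_substitution_def)
  then show ?thesis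
    using assms is_homD(3)[OF is_hom_Const] by (auto simp: is_substitution_def is_hom_def)
qed

text \<open>The image of \<open>inverse y\<close> inverts the image of a nonzero \<open>y\<close>,
  so no denominator is lost. For \<open>y = 0\<close> both sides are 0 by convention.\<close>

lemma is_hom_fract_divide:
  fixes f :: "'a::field \<Rightarrow> 'b::field"
  assumes "is_hom f"
  shows "f (x / y) = f x / f y"
proof (cases "y = 0")
  case False
  then have "f (x / y) * f y = f x" "f y * f (inverse y) = 1"
    using is_homD(2,3)[OF assms] by (metis nonzero_eq_divide_eq, metis right_inverse)
  then show ?thesis
    by (metis mult_zero_left nonzero_eq_divide_eq zero_neq_one)
qed (simp add: is_homD[OF assms])

lemma is_substitution_unique:
  assumes "is_substitution F \<sigma>" "is_substitution F \<tau>"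
  shows "\<sigma> = \<tau>"
proof
  fix r
  note hom = assms[THEN is_substitution_hom]
  have *: "\<sigma> (to_fract p) = \<tau> (to_fract p)" for p
    using assms
    by (induction p rule: poly3_closure_induct)
      (simp_all add: is_substitution_def is_homD[OF hom(1)] is_homD[OF hom(2)] flip: Const_def Var_eq)
  obtain a b :: "complex poly poly poly" where "r = Fract a b"
    by (cases r) blast
  then show "\<sigma> r = \<tau> r"
    by (simp add: Fract_conv_to_fract is_hom_fract_divide[OF hom(1)] is_hom_fract_divide[OF hom(2)] *)
qed

section \<open>The rotation formula as an involutive substitution\<close>

lemma rotation_formula_involution:
  fixes x y z :: "'a::field"
  assumes "x \<noteq> 0" "y \<noteq> 0" "z \<noteq> 0" "1 + x + x * z \<noteq> 0" "1 + y + y * x \<noteq> 0" "1 + z + z * y \<noteq> 0"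
  shows "rotation_formula (rotation_formula x y z) (rotation_formula y z x) (rotation_formula z x y) = x"
proof -
  define a b c where abc: "a = 1 + x + x * z" "b = 1 + y + y * x" "c = 1 + z + z * y"
  have nz: "a \<noteq> 0" "b \<noteq> 0" "c \<noteq> 0"
    using assms abc by auto
  have r: "rotation_formula x y z = a / (z * b)" "rotation_formula y z x = b / (x * c)"
    "rotation_formula z x y = c / (y * a)"
    by (simp_all add: rotation_formula_def abc mult.commute)
  \<comment> \<open>Write \<open>X\<close>, \<open>Y\<close>, \<open>Z\<close> for the three inner
    values. These factorizations collapse the outer trinomials to
    \<open>1 + X + X * Z = c / (y * z)\<close> and
    \<open>1 + Y + X * Y = a / (x * z)\<close>.\<close>
  have "z * b * y + a * y + c = b * c" "x * z * c + z * b + a = a * c"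
    unfolding abc by algebra+
  moreover have "1 + a / (z * b) + a / (z * b) * (c / (y * a)) = (z * b * y + a * y + c) / (z * b * y)"
    using assms(1-3) nz by (simp add: field_simps)
  moreover have "1 + b / (x * c) + a / (z * b) * (b / (x * c)) = (x * z * c + z * b + a) / (x * z * c)"
    using assms(1-3) nz by (simp add: field_simps)
  ultimately show ?thesis
    unfolding r unfolding rotation_formula_def using assms(1-3) nz by (simp add: field_simps)
qed

definition is_rotation :: "(color \<Rightarrow> ratfun) \<Rightarrow> color \<Rightarrow> color \<Rightarrow> color \<Rightarrow> bool" where
  "is_rotation F i j k \<longleftrightarrow> UNIV = {i, j, k} \<and> F i = rotation_formula (Var i) (Var j) (Var k) \<and>
     F j = rotation_formula (Var j) (Var k) (Var i) \<and> F k = rotation_formula (Var k) (Var i) (Var j)"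

lemma is_rotation_cycle: "is_rotation F i j k \<Longrightarrow> is_rotation F j k i"
  by (auto simp: is_rotation_def)

lemma (in positive_cone) rotation_formula: "P x \<Longrightarrow> P y \<Longrightarrow> P z \<Longrightarrow> P (rotation_formula x y z)"
  unfolding rotation_formula_def by (intro divide add mult one)

lemma is_rotation_positive:
  assumes "is_rotation F i j k"
  shows "positive (F \<alpha>)"
proof -
  have "\<alpha> = i \<or> \<alpha> = j \<or> \<alpha> = k"
    using assms unfolding is_rotation_def by blast
  then show ?thesis
    using assms positive.rotation_formula[OF positive_Var positive_Var positive_Var]
    by (auto simp: is_rotation_def)
qed

lemma is_rotation_involution:
  assumes "is_rotation F i j k"
  shows "rotation_formula (F i) (F j) (F k) = Var i"
  using assms unfolding is_rotation_def
  by (simp add: rotation_formula_involution positive.nonzero positive.add positive.mult positive.one positive_Var)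

text \<open>A cyclic change of roles puts the given color first.\<close>

lemma is_rotation_involution_all:
  assumes "is_rotation F i j k"
  obtains i' j' k' where "F \<alpha> = rotation_formula (Var i') (Var j') (Var k')"
    "rotation_formula (F i') (F j') (F k') = Var \<alpha>"
proof -
  have "\<alpha> = i \<or> \<alpha> = j \<or> \<alpha> = k"
    using assms unfolding is_rotation_def by blast
  then show ?thesis
    using that[of i j k] that[of j k i] that[of k i j] assms
      is_rotation_involution[OF assms] is_rotation_involution[OF is_rotation_cycle[OF assms]]
      is_rotation_involution[OF is_rotation_cycle[OF is_rotation_cycle[OF assms]]]
    unfolding is_rotation_def by blast
qed

text \<open>The substitution homomorphism \<open>h\<close> on polynomials is injective because its partial extension
  to fractions maps \<open>F\<close> back to the variables.\<close>

lemma is_rotation_substitution: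
  assumes "is_rotation F i j k"
  shows "\<exists>\<sigma>. is_substitution F \<sigma>"
proof -
  define h where "h = eval_poly3 Const F"
  have h: "is_hom h" and h_const: "\<And>c. h [:[:[:c:]:]:] = Const c" and h_Var: "\<And>\<alpha>. h (Var_poly \<alpha>) = F \<alpha>"
    unfolding h_def by (simp_all add: is_hom_eval_poly3 eval_poly3_const eval_poly3_Var is_hom_Const)
  have ext_const: "fract_ext h (Const c) (Const c)" for c
    using fract_ext_to_fract[OF h, of "[:[:[:c:]:]:]"] h_const by (simp add: Const_def)
  have ext_Var: "fract_ext h (Var \<alpha>) (F \<alpha>)" for \<alpha>
    using fract_ext_to_fract[OF h, of "Var_poly \<alpha>"] by (simp add: Var_eq h_Var)
  have ext_F: "fract_ext h (F \<alpha>) (Var \<alpha>)" for \<alpha>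
  proof -
    obtain i' j' k' where F: "F \<alpha> = rotation_formula (Var i') (Var j') (Var k')"
      and Var: "rotation_formula (F i') (F j') (F k') = Var \<alpha>"
      using is_rotation_involution_all[OF assms] by blast
    have "F k' * (1 + F j' + F i' * F j') \<noteq> 0"
      by (intro positive.nonzero positive.mult positive.add positive.one is_rotation_positive[OF assms])
    then show ?thesis
      unfolding F Var[symmetric] unfolding rotation_formula_def
      by (intro fract_ext_divide[OF h] fract_ext_add[OF h] fract_ext_mult[OF h] fract_ext_1[OF h] ext_Var)
  qed
  have ext_h: "fract_ext h (h p) (to_fract p)" for p
  proof (induction p rule: poly3_closure_induct)
    case (const c)
    then show ?case
      using ext_const[of c] by (simp add: h_const flip: Const_def)
  next
    case (var \<alpha>)
    then show ?case
      using ext_F[of \<alpha>] by (simp add: h_Var flip: Var_eq)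
  next
    case (add p q)
    then show ?case
      by (simp add: is_homD(1)[OF h] fract_ext_add[OF h])
  next
    case (mult p q)
    then show ?case
      by (simp add: is_homD(2)[OF h] fract_ext_mult[OF h])
  qed
  have "p = 0" if "h p = 0" for p
    using fract_ext_unique[OF h ext_h[of p, unfolded that] fract_ext_0[OF h]] by simp
  then obtain g where g: "is_hom g" "\<And>p. g (to_fract p) = h p"
    using inj_fract_ext_hom[OF h] by blast
  then have "is_substitution F g"
    by (auto simp: is_substitution_def is_homD[OF g(1)] Const_def Var_eq h_Var g(2) h_const)
  then show ?thesis
    by blast
qed

text \<open>Both \<open>\<sigma> \<circ> \<sigma>\<close> and the identity substitute each variable
  for itself, so uniqueness of substitutions identifies them.\<close>

lemma is_rotation_substitution_involution:
  assumes "is_rotation F i j k" "is_substitution F \<sigma>"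
  shows "\<sigma> \<circ> \<sigma> = id"
proof (rule is_substitution_unique)
  note hom = is_substitution_hom[OF assms(2)]
  have Var: "\<sigma> (Var \<alpha>) = F \<alpha>" for \<alpha>
    using assms(2) by (simp add: is_substitution_def)
  have "\<sigma> (F \<alpha>) = Var \<alpha>" for \<alpha>
  proof -
    obtain i' j' k' where F: "F \<alpha> = rotation_formula (Var i') (Var j') (Var k')"
      and "rotation_formula (F i') (F j') (F k') = Var \<alpha>"
      using is_rotation_involution_all[OF assms(1)] by blast
    moreover have "\<sigma> (F \<alpha>) = rotation_formula (F i') (F j') (F k')"
      unfolding F rotation_formula_def by (simp add: is_hom_fract_divide[OF hom] is_homD[OF hom] Var)
    ultimately show ?thesis
      by simp
  qed
  then show "is_substitution Var (\<sigma> \<circ> \<sigma>)"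
    using assms(2) by (simp add: is_substitution_def)
  show "is_substitution Var id"
    by (simp add: is_substitution_def)
qed

section \<open>Path independence and the resulting rotation formula\<close>

lemma mutation_formula_path_independent:
  assumes "colored_triangulation T" "flip_path T p T'" "flip_path T q T'"
  shows "mutation_formula T p = mutation_formula T q"
proof -
  obtain A :: "nat \<Rightarrow> nat \<Rightarrow> ratfun" where "lambda_lengths A" and A: "coords A T = Var"
    using positive.lambda_lengths_exist[of T Var, OF assms(1) positive_Var] by (elim exE conjE)
  then interpret lambda_lengths A
    by simp
  show ?thesis
    using flip_path_coords[OF assms(2,1)] flip_path_coords[OF assms(3,1)]
    by (simp add: mutation_formula_def flip: A)
qed

lemma triangle_mutation_formula:
  assumes "colored_triangulation T" "triangle a T i j k" "flip_path T p (rotate_pi T)"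
  shows "is_rotation (mutation_formula T p) i j k"
  using positive.triangle_rotate_pi_coords[OF assms(1,2) positive_Var assms(3)] assms(2)
  by (simp add: is_rotation_def mutation_formula_def triangle_def)

lemma equilateral_triangle:
  assumes "colored_triangulation T" "equilateral T"
  obtains a i j k where "triangle a T i j k"
proof -
  obtain a where "a < 6" "range T = {{a, (a + 2) mod 6}, {(a + 2) mod 6, (a + 4) mod 6}, {(a + 4) mod 6, a}}"
    using assms(2) unfolding equilateral_def by blast
  then have "range T = {{rot a 0, rot a 2}, {rot a 2, rot a 4}, {rot a 4, rot a 0}}"
    by (simp add: rot_def)
  then show ?thesis
    using that by (rule triangle_of_range[OF assms(1)])
qed

lemma reference_triangle:
  assumes "reference_triangulation T"
  obtains a where "triangle a T Orange Green Blue"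
proof -
  obtain a where "a < 6" "T Orange = {a, (a + 2) mod 6}" "T Green = {(a + 2) mod 6, (a + 4) mod 6}"
    "T Blue = {(a + 4) mod 6, a}"
    using assms unfolding reference_triangulation_def by blast
  then have "triangle a T Orange Green Blue"
    by (auto simp: triangle_def rot_def UNIV_color)
  then show ?thesis
    using that by blast
qed

theorem theorem3p5:
  shows
    "(\<forall>T T' p q. colored_triangulation T \<longrightarrow> flip_path T p T' \<longrightarrow> flip_path T q T' \<longrightarrow>
        mutation_formula T p = mutation_formula T q) \<and>
     (\<forall>T. colored_triangulation T \<and> equilateral T \<longrightarrow>
        (\<exists>F. (\<exists>p. flip_path T p (rotate_pi T)) \<and>
             (\<forall>p. flip_path T p (rotate_pi T) \<longrightarrow> mutation_formula T p = F) \<and>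
             (\<exists>!\<sigma>. is_substitution F \<sigma>) \<and>
             (\<forall>\<sigma>. is_substitution F \<sigma> \<longrightarrow> \<sigma> \<circ> \<sigma> = id))) \<and>
     (\<forall>T p. colored_triangulation T \<and> reference_triangulation T \<and> flip_path T p (rotate_pi T) \<longrightarrow>
        mutation_formula T p Orange =
          (1 + Var Orange + Var Orange * Var Blue) /
          (Var Blue * (1 + Var Green + Var Orange * Var Green)) \<and>
        mutation_formula T p Blue =
          (1 + Var Blue + Var Blue * Var Green) /
          (Var Green * (1 + Var Orange + Var Orange * Var Blue)) \<and>
        mutation_formula T p Green =
          (1 + Var Green + Var Orange * Var Green) /
          (Var Orange * (1 + Var Blue + Var Blue * Var Green)))"
proof (intro conjI allI impI)
  fix T T' p q
  assume "colored_triangulation T" "flip_path T p T'" "flip_path T q T'"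
  then show "mutation_formula T p = mutation_formula T q"
    by (rule mutation_formula_path_independent)
next
  fix T
  assume "colored_triangulation T \<and> equilateral T"
  then have T: "colored_triangulation T" and "equilateral T"
    by simp_all
  then obtain a i j k where tri: "triangle a T i j k"
    using equilateral_triangle by blast
  then obtain p where p: "flip_path T p (rotate_pi T)"
    using flip_path_rotate_pi by blast
  define F where "F = mutation_formula T p"
  have rotation: "is_rotation F i j k"
    unfolding F_def using T tri p by (rule triangle_mutation_formula)
  obtain \<sigma> where \<sigma>: "is_substitution F \<sigma>"
    using is_rotation_substitution[OF rotation] by blast
  show "\<exists>F. (\<exists>p. flip_path T p (rotate_pi T)) \<and>
      (\<forall>p. flip_path T p (rotate_pi T) \<longrightarrow> mutation_formula T p = F) \<and>
      (\<exists>!\<sigma>. is_substitution F \<sigma>) \<and> (\<forall>\<sigma>. is_substitution F \<sigma> \<longrightarrow> \<sigma> \<circ> \<sigma> = id)"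
  proof (intro exI[of _ F] conjI allI impI)
    show "\<exists>p. flip_path T p (rotate_pi T)"
      using p by blast
    show "mutation_formula T q = F" if "flip_path T q (rotate_pi T)" for q
      unfolding F_def using T that p by (rule mutation_formula_path_independent)
    show "\<exists>!\<sigma>. is_substitution F \<sigma>"
      using \<sigma> is_substitution_unique by blast
    show "\<tau> \<circ> \<tau> = id" if "is_substitution F \<tau>" for \<tau>
      using rotation that by (rule is_rotation_substitution_involution)
  qed
next
  fix T p
  assume *: "colored_triangulation T \<and> reference_triangulation T \<and> flip_path T p (rotate_pi T)"
  then obtain a where "triangle a T Orange Green Blue"
    using reference_triangle by blast
  \<comment> \<open>The colors are in counterclockwise order, so the third argument of
    \<open>rotation_formula\<close> for orange is blue.\<close>
  then have "is_rotation (mutation_formula T p) Orange Green Blue"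
    using * triangle_mutation_formula by blast
  then show "mutation_formula T p Orange =
        (1 + Var Orange + Var Orange * Var Blue) / (Var Blue * (1 + Var Green + Var Orange * Var Green))"
    and "mutation_formula T p Blue =
        (1 + Var Blue + Var Blue * Var Green) / (Var Green * (1 + Var Orange + Var Orange * Var Blue))"
    and "mutation_formula T p Green =
        (1 + Var Green + Var Orange * Var Green) / (Var Orange * (1 + Var Blue + Var Blue * Var Green))"
    by (simp_all only: is_rotation_def rotation_formula_def mult.commute)
qed

end
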